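(* Let $\mathbb K$ be a field. (1) If $F\in\mathbb K\langle x,y\rangle$ is a homogeneous potential of degree $n\ge 4$, then the potential algebra $A_F$ is infinite dimensional over $\mathbb K$. (2) Moreover, for every $n\ge 3$, let $\mathcal P_n$ be the class of potential algebras $A_F$ with $F\in\mathbb K\langle x,y\rangle$ a homogeneous potential of degree $n+1\geq 4$. Then the minimal Hilbert series in the class $\mathcal P_n$ is $$H_n=\frac{1}{1-2t+2t^n-t^{n+1}},$$ that is, $H_A\ge H_n$ coefficientwise for every $A\in\mathcal P_n$, and there is an $A\in\mathcal P_n$ with $H_A=H_n$.
   Context: $\mathbb K\langle x,y\rangle$ is the free associative unital algebra on $x,y$, with $\deg x=\deg y=1$. A polynomial $F\in\mathbb K\langle x,y\rangle$ is cyclicly invariant if it is fixed by the linear map sending each monomial $zu$ ($z\in\{x,y\}$, $u$ a monomial) to $uz$ and fixing constants. The linear maps $\partial_x,\partial_y:\mathbb K\langle x,y\rangle\to\mathbb K\langle x,y\rangle$ are defined on monomials by $\partial_x w=u$ if $w=xu$ and $\partial_x w=0$ otherwise; $\partial_y w=u$ if $w=yu$ and $\partial_y w=0$ otherwise. A potential is a cyclicly invariant polynomial $F$, and its potential algebra is $A_F=\mathbb K\langle x,y\rangle/I_F$, where $I_F$ is the two-sided ideal generated by $\partial_xF$ and $\partial_yF$. When $F$ is homogeneous, $A_F=\bigoplus_{j\ge0}A_j$ is graded and its Hilbert series is $H_A(t)=\sum_{j\ge0}(\dim_{\mathbb K}A_j)t^j$. Power series are compared coefficientwise; rational functions are identified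 with their Taylor series at $0$. *)

theory Defs
  imports
    "HOL-Library.Poly_Mapping"
    "HOL-Algebra.Embedded_Algebras"
    "HOL-Algebra.QuotRing"
    "HOL-Algebra.Algebraic_Closure_Type"
    "HOL-Computational_Algebra.Formal_Power_Series"
begin

section \<open>The free associative algebra on two generators\<close>

datatype letter = Lx | Ly

text \<open>
  The free monoid on \<open>x, y\<close>, written additively (concatenation is \<open>+\<close>, the empty word is \<open>0\<close>),
  because the convolution product of \<^theory>\<open>HOL-Library.Poly_Mapping\<close> expects an additive index
  monoid. A separate type keeps this instance off \<^typ>\<open>letter list\<close>.
\<close>

datatype word = Word (letters: "letter list")

instantiation word :: monoid_add
begin

definition zero_word :: word where "0 = Word []"

definition plus_word :: "word \<Rightarrow> word \<Rightarrow> word" where "u + v = Word (letters u @ letters v)"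

instance
  by standard (simp_all add: zero_word_def plus_word_def)

end

text \<open>
  With this index monoid, the \<open>ring_1\<close> instance of \<open>\<Rightarrow>\<^sub>0\<close> is the monoid algebra of the free monoid,
  that is, the free algebra on \<open>x, y\<close> over \<open>'k\<close>.
\<close>

type_synonym 'k free_poly = "word \<Rightarrow>\<^sub>0 'k"

abbreviation monomial :: "word \<Rightarrow> 'k::field free_poly" where
  "monomial w \<equiv> Poly_Mapping.single w 1"

definition scalar :: "'k::field \<Rightarrow> 'k free_poly" where
  "scalar c = Poly_Mapping.single 0 c"

definition linear_extension ::
    "(word \<Rightarrow> 'k::field free_poly) \<Rightarrow> 'k free_poly \<Rightarrow> 'k free_poly" where
  "linear_extension f p = (\<Sum>w\<in>Poly_Mapping.keys p. scalar (Poly_Mapping.lookup p w) * f w)"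

definition homogeneous :: "nat \<Rightarrow> 'k::field free_poly \<Rightarrow> bool" where
  "homogeneous j p \<longleftrightarrow> (\<forall>w\<in>Poly_Mapping.keys p. length (letters w) = j)"

section \<open>Potentials and potential algebras\<close>

definition cyclic_shift :: "'k::field free_poly \<Rightarrow> 'k free_poly" where
  "cyclic_shift = linear_extension (\<lambda>w. monomial (Word (rotate1 (letters w))))"

definition potential :: "'k::field free_poly \<Rightarrow> bool" where
  "potential F \<longleftrightarrow> cyclic_shift F = F"

definition partial :: "letter \<Rightarrow> 'k::field free_poly \<Rightarrow> 'k free_poly" where
  "partial z = linear_extension
     (\<lambda>w. case letters w of [] \<Rightarrow> 0 | a # u \<Rightarrow> if a = z then monomial (Word u) else 0)"

text \<open>The zero polynomial is homogeneous of every degree and hence is included here.\<close>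

definition homogeneous_potentials :: "nat \<Rightarrow> 'k::field free_poly set" where
  "homogeneous_potentials n = {F. potential F \<and> homogeneous n F}"

abbreviation free_alg :: "'k::field free_poly ring" where
  "free_alg \<equiv> ring_of_type_algebra"

definition potential_ideal :: "'k::field free_poly \<Rightarrow> 'k free_poly set" where
  "potential_ideal F = Idl\<^bsub>free_alg\<^esub> {partial Lx F, partial Ly F}"

definition potential_algebra :: "'k::field free_poly \<Rightarrow> 'k free_poly set ring" where
  "potential_algebra F = free_alg Quot potential_ideal F"

definition residue_class :: "'k::field free_poly \<Rightarrow> 'k free_poly \<Rightarrow> 'k free_poly set" where
  "residue_class F p = potential_ideal F +>\<^bsub>free_alg\<^esub> p"

section \<open>Dimension and Hilbert series\<close>

text \<open>
  \<^theory>\<open>HOL-Algebra.Embedded_Algebras\<close> measures dimension over a subfield of the ring, so the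
  ground field enters through its image in the potential algebra. This image is a copy of \<open>'k\<close>
  as soon as the algebra is nonzero; for \<open>F\<close> homogeneous of degree at least \<open>2\<close> it always is, since
  the ideal is then generated in positive degree.
\<close>

definition ground_field :: "'k::field free_poly \<Rightarrow> 'k free_poly set set" where
  "ground_field F = range (\<lambda>c. residue_class F (scalar c))"

definition infinite_dimensional :: "'k::field free_poly \<Rightarrow> bool" where
  "infinite_dimensional F \<longleftrightarrow>
     \<not> ring.finite_dimension (potential_algebra F) (ground_field F) (carrier (potential_algebra F))"

definition graded_component :: "'k::field free_poly \<Rightarrow> nat \<Rightarrow> 'k free_poly set set" where
  "graded_component F j = residue_class F ` {p. homogeneous j p}"

definition hilbert_series :: "'k::field free_poly \<Rightarrow> rat fps" where
  "hilbert_series F =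
     Abs_fps (\<lambda>j. of_nat (ring.dim (potential_algebra F) (ground_field F) (graded_component F j)))"

definition coeffwise_le :: "rat fps \<Rightarrow> rat fps \<Rightarrow> bool" where
  "coeffwise_le f g \<longleftrightarrow> (\<forall>j. fps_nth f j \<le> fps_nth g j)"

definition minimal_series :: "nat \<Rightarrow> rat fps" where
  "minimal_series n = 1 / (1 - 2 * fps_X + 2 * fps_X ^ n - fps_X ^ (n + 1))"

end

theory Submission
  imports Defs "HOL-Computational_Algebra.Polynomial_Factorial"
begin

text \<open>
  Let \<open>F\<close> be a homogeneous potential of degree \<open>n + 1\<close> with \<open>n \<ge> 3\<close>, let \<open>r\<^sub>x\<close> and \<open>r\<^sub>y\<close> be its
  derivatives, and let \<open>I\<^sub>m\<close> be the part of degree \<open>m\<close> of the ideal that they generate. The degree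
  \<open>m\<close> part of the potential algebra has dimension \<open>2^m - dim I\<^sub>m\<close>, so a lower bound for the Hilbert
  series is an upper bound for \<open>dim I\<^sub>m\<close>.

  Call a word normal if it contains neither \<open>x^(n-2) y y\<close> nor \<open>x^(n-1) y\<close>, and assume first that the
  normal words span the algebra, as they do when the relations \<open>r\<^sub>x\<close> and \<open>r\<^sub>y\<close> rewrite
  these two words into smaller ones. Then \<open>I\<^sub>m\<close> is spanned by \<open>x I\<^sub>m\<^sub>-\<^sub>1\<close>, \<open>y I\<^sub>m\<^sub>-\<^sub>1\<close> and the products
  \<open>r\<^sub>x w\<close> and \<open>r\<^sub>y w\<close> with \<open>w\<close> normal. Cyclic invariance gives the syzygy
  \<open>x r\<^sub>x + y r\<^sub>y = r\<^sub>x x + r\<^sub>y y\<close>, which makes the products \<open>r\<^sub>y w\<close> with \<open>w\<close> beginning with \<open>y\<close>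
  superfluous. Unfolding the recursion, the remaining spanning elements \<open>u r\<^sub>x w\<close> and \<open>u r\<^sub>y w\<close>
  correspond to the non-normal words, cut at their last forbidden subword. Hence \<open>dim I\<^sub>m\<close> is at
  most the number of non-normal words, with no analysis of ambiguities between the relations
  (\<open>ideal_part_subset_reducible_span\<close>). The numbers of normal words satisfy the
  recurrence that \<open>1 - 2t + 2t^n - t^(n+1)\<close> encodes (\<open>card_normal_words_recurrence\<close>).

  The assumption holds for the model potential, the sum of all rotations of \<open>x^(n-1) y y\<close>: its
  derivatives are monic with the two forbidden words as leading terms, and all their other terms have
  fewer inversions. For the model potential the bound is an equality, which gives the minimum.

  For arbitrary \<open>F\<close> the normal words need not span (take \<open>F = 0\<close>). Therefore the model potential \<open>M\<close>
  is joined to \<open>F\<close> by the pencil \<open>(1 - t) M + t F\<close> over the rational functions in \<open>t\<close>. Linear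
  independence of a family with polynomial coefficients can only be lost when \<open>t\<close> is given a value.
  At \<open>t = 0\<close> this transfers the spanning assumption from \<open>M\<close> to the pencil, so the bound holds for the
  pencil; at \<open>t = 1\<close> it shows that \<open>dim I\<^sub>m\<close> for \<open>F\<close> is at most its value for the pencil
  (\<open>dim_ideal_part_le_card_reducible_words\<close>). As \<open>t\<close> is an indeterminate, the field may be finite.

  The algebra is infinite dimensional because there is a normal word of every length, so all its
  homogeneous components are nonzero.
\<close>

section \<open>The free algebra as a graded vector space\<close>

abbreviation mon :: "letter list \<Rightarrow> 'k::field free_poly" where
  "mon l \<equiv> monomial (Word l)"

definition fscale :: "'k::field \<Rightarrow> 'k free_poly \<Rightarrow> 'k free_poly" (infixr "\<cdot>" 75) where
  "c \<cdot> p = scalar c * p"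

lemma lookup_fscale [simp]: "Poly_Mapping.lookup (c \<cdot> p) w = c * Poly_Mapping.lookup p w"
  unfolding fscale_def scalar_def mult_map_scale_conv_mult [symmetric]
  by (simp add: Poly_Mapping.map.rep_eq when_def)

interpretation fa: vector_space "fscale :: 'k::field \<Rightarrow> 'k free_poly \<Rightarrow> 'k free_poly"
  by standard (auto intro!: poly_mapping_eqI simp: lookup_add algebra_simps)

lemma plus_Word [simp]: "Word u + Word v = Word (u @ v)"
  by (simp add: plus_word_def)

lemma word_zero: "0 = Word []"
  by (simp add: zero_word_def)

lemma mon_Nil [simp]: "mon [] = 1"
  by (simp flip: word_zero)

lemma mon_mult [simp]: "mon u * mon v = mon (u @ v)"
  by (simp add: mult_single)

lemma mon_mult_assoc [simp]: "mon u * (mon v * p) = mon (u @ v) * p"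
  by (simp flip: mult.assoc)

lemma lookup_mon_mult:
  "Poly_Mapping.lookup (mon u * p) (Word (u @ s)) = Poly_Mapping.lookup p (Word s)"
proof -
  have "Poly_Mapping.lookup (mon u * p) (Word (u @ s))
    = (\<Sum>l. (\<Sum>q. Poly_Mapping.lookup p q when Word (u @ s) = l + q) when l = Word u)"
    unfolding lookup_mult lookup_single
    by (intro Sum_any.cong) (auto simp: when_def)
  also have "\<dots> = (\<Sum>q. Poly_Mapping.lookup p q when Word (u @ s) = Word u + q)"
    by simp
  also have "\<dots> = (\<Sum>q. Poly_Mapping.lookup p q when q = Word s)"
  proof (intro Sum_any.cong)
    fix q show "(Poly_Mapping.lookup p q when Word (u @ s) = Word u + q) =
        (Poly_Mapping.lookup p q when q = Word s)"
      by (cases q) (auto simp: when_def)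
  qed
  finally show ?thesis by simp
qed

lemma lookup_mon_mult_zero:
  assumes "\<And>t. s \<noteq> u @ t"
  shows "Poly_Mapping.lookup (mon u * p) (Word s) = 0"
proof -
  have "Word s \<noteq> Word u + q" for q
    using assms by (cases q) auto
  then have "(\<Sum>l. Poly_Mapping.lookup (mon u) l *
      (\<Sum>q. Poly_Mapping.lookup p q when Word s = l + q)) = (\<Sum>l::word. 0)"
    by (intro Sum_any.cong) (auto simp: lookup_single when_def)
  then show ?thesis by (simp add: lookup_mult)
qed

lemma lookup_mult_mon:
  "Poly_Mapping.lookup (p * mon v) (Word (s @ v)) = Poly_Mapping.lookup p (Word s)"
proof -
  have "Poly_Mapping.lookup (p * mon v) (Word (s @ v))
    = (\<Sum>l. Poly_Mapping.lookup p l * (\<Sum>q. (1 when Word (s @ v) = l + q) when q = Word v))"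
    unfolding lookup_mult lookup_single
    by (intro Sum_any.cong arg_cong2[where f = "(*)"]) (auto simp: when_def)
  also have "\<dots> = (\<Sum>l. Poly_Mapping.lookup p l when l = Word s)"
  proof (intro Sum_any.cong)
    fix l show "Poly_Mapping.lookup p l * (\<Sum>q. (1 when Word (s @ v) = l + q) when q = Word v) =
        (Poly_Mapping.lookup p l when l = Word s)"
      by (cases l) (auto simp: when_def)
  qed
  finally show ?thesis by simp
qed

lemma lookup_mult_mon_zero:
  assumes "\<And>t. s \<noteq> t @ v"
  shows "Poly_Mapping.lookup (p * mon v) (Word s) = 0"
proof -
  have *: "Word s \<noteq> l + Word v" for l
    using assms by (cases l) auto
  have "Poly_Mapping.lookup (p * mon v) (Word s)
    = (\<Sum>l. Poly_Mapping.lookup p l * (\<Sum>q. (1 when Word s = l + q) when q = Word v))"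
    unfolding lookup_mult lookup_single
    by (intro Sum_any.cong arg_cong2[where f = "(*)"]) (auto simp: when_def)
  also have "\<dots> = (\<Sum>l::word. 0)"
    using * by (intro Sum_any.cong) auto
  finally show ?thesis by simp
qed

lemma free_poly_eqI:
  assumes "\<And>s. Poly_Mapping.lookup p (Word s) = Poly_Mapping.lookup q (Word s)"
  shows "p = q"
  by (intro poly_mapping_eqI) (metis assms word.exhaust)

lemma expand_free_poly:
  "p = (\<Sum>w\<in>Poly_Mapping.keys p. Poly_Mapping.lookup p w \<cdot> monomial w)"
  by (intro poly_mapping_eqI)
     (simp add: lookup_sum lookup_single when_def if_distrib in_keys_iff cong: if_cong)

lemma scalar_central: "p * scalar c = scalar c * p"
proof -
  have *: "monomial w * scalar c = scalar c * monomial w" for w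
    by (simp add: scalar_def mult_single)
  have "(\<Sum>w\<in>Poly_Mapping.keys p. Poly_Mapping.lookup p w \<cdot> monomial w) * scalar c =
      (\<Sum>w\<in>Poly_Mapping.keys p. scalar c * (Poly_Mapping.lookup p w \<cdot> monomial w))"
  proof (unfold sum_distrib_right, intro sum.cong refl)
    fix w
    have "scalar (Poly_Mapping.lookup p w) * scalar c = scalar c * scalar (Poly_Mapping.lookup p w)"
      by (simp add: scalar_def mult_single mult.commute)
    then show "Poly_Mapping.lookup p w \<cdot> monomial w * scalar c =
        scalar c * (Poly_Mapping.lookup p w \<cdot> monomial w)"
      by (simp add: fscale_def mult.assoc *) (simp flip: mult.assoc)
  qed
  then show ?thesis
    by (simp flip: sum_distrib_left expand_free_poly)
qed

lemma fscale_mult_left: "(c \<cdot> p) * q = c \<cdot> (p * q)"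
  by (simp add: fscale_def mult.assoc)

lemma fscale_mult_right: "p * (c \<cdot> q) = c \<cdot> (p * q)"
  by (metis fscale_def mult.assoc scalar_central)

lemma scalar_add: "scalar (a + b) = scalar a + scalar b"
  by (simp add: scalar_def single_add)

lemma scalar_mult: "scalar (a * b) = scalar a * scalar b"
  by (simp add: scalar_def mult_single)

lemma scalar_1 [simp]: "scalar 1 = 1"
  by (simp add: scalar_def)

lemma scalar_0 [simp]: "scalar 0 = 0"
  by (simp add: scalar_def)

lemma span_mult_closed:
  assumes "p \<in> fa.span S" "\<And>s. s \<in> S \<Longrightarrow> a * s * b \<in> fa.span T"
  shows "a * p * b \<in> fa.span T"
  using assms(1)
proof (induction rule: fa.span_induct_alt)
  case base
  then show ?case by (simp add: fa.span_zero)
next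
  case (step c x y)
  have "a * (c \<cdot> x + y) * b = c \<cdot> (a * x * b) + a * y * b"
    by (simp add: distrib_left distrib_right fscale_mult_left fscale_mult_right)
  then show ?case
    using step assms(2) by (simp add: fa.span_add fa.span_scale)
qed

lemma span_lmult_closed:
  assumes "p \<in> fa.span S" "\<And>s. s \<in> S \<Longrightarrow> a * s \<in> fa.span T"
  shows "a * p \<in> fa.span T"
  using span_mult_closed[of p S a 1 T] assms by simp

lemma span_rmult_closed:
  assumes "p \<in> fa.span S" "\<And>s. s \<in> S \<Longrightarrow> s * b \<in> fa.span T"
  shows "p * b \<in> fa.span T"
  using span_mult_closed[of p S 1 b T] assms by simp


definition words :: "nat \<Rightarrow> letter list set" where
  "words m = {l. length l = m}"

lemma UNIV_letter: "(UNIV :: letter set) = {Lx, Ly}"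
  using letter.exhaust by auto

lemma finite_words [simp]: "finite (words m)" and card_words: "card (words m) = 2 ^ m"
proof -
  have "finite (UNIV :: letter set)" "card (UNIV :: letter set) = 2"
    by (simp_all add: UNIV_letter)
  then show "finite (words m)" "card (words m) = 2 ^ m"
    using finite_lists_length_eq[of "UNIV :: letter set" m]
      card_lists_length_eq[of "UNIV :: letter set" m]
    by (simp_all add: words_def)
qed

abbreviation hom_part :: "nat \<Rightarrow> 'k::field free_poly set" where
  "hom_part m \<equiv> {p. homogeneous m p}"

lemma homogeneous_alt:
  "homogeneous m p \<longleftrightarrow> (\<forall>l. length l \<noteq> m \<longrightarrow> Poly_Mapping.lookup p (Word l) = 0)"
proof -
  have "homogeneous m p \<longleftrightarrow>
      (\<forall>w. length (letters w) \<noteq> m \<longrightarrow> Poly_Mapping.lookup p w = 0)"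
    by (auto simp: homogeneous_def in_keys_iff)
  also have "\<dots> \<longleftrightarrow> (\<forall>l. length l \<noteq> m \<longrightarrow> Poly_Mapping.lookup p (Word l) = 0)"
    by (metis word.collapse word.sel)
  finally show ?thesis .
qed

lemma subspace_hom_part: "fa.subspace (hom_part m)"
  by (auto simp: fa.subspace_def homogeneous_alt lookup_add)

lemma homogeneous_mon [simp]: "homogeneous m (mon l) \<longleftrightarrow> length l = m"
  by (auto simp: homogeneous_alt lookup_single when_def)

lemma span_words: "fa.span (mon ` words m) = hom_part m"
proof
  show "fa.span (mon ` words m) \<subseteq> hom_part m"
    by (intro fa.span_minimal subspace_hom_part) (auto simp: words_def)
  show "hom_part m \<subseteq> fa.span (mon ` words m :: 'a free_poly set)"
  proof
    fix p :: "'a free_poly" assume p: "p \<in> hom_part m"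
    have "Poly_Mapping.lookup p w \<cdot> monomial w \<in> fa.span (mon ` words m)"
      if "w \<in> Poly_Mapping.keys p" for w
    proof (intro fa.span_scale fa.span_base)
      show "(monomial w :: 'a free_poly) \<in> mon ` words m"
        using p that by (intro image_eqI[of _ _ "letters w"]) (auto simp: words_def homogeneous_def)
    qed
    then show "p \<in> fa.span (mon ` words m)"
      by (subst expand_free_poly) (rule fa.span_sum)
  qed
qed

lemma inj_mon: "inj (mon :: letter list \<Rightarrow> 'k::field free_poly)"
proof (rule injI)
  fix u v assume "mon u = (mon v :: 'k free_poly)"
  then have "Poly_Mapping.lookup (mon u :: 'k free_poly) (Word v) = (1 :: 'k)" by simp
  then show "u = v" by (auto simp: lookup_single when_def split: if_splits)
qed

lemma independent_mons:
  assumes "finite W"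
  shows "fa.independent (mon ` W :: 'k::field free_poly set)"
proof (rule fa.independent_if_scalars_zero)
  show "finite (mon ` W)" using assms by simp
next
  fix f :: "'k free_poly \<Rightarrow> 'k" and x :: "'k free_poly"
  assume *: "(\<Sum>x\<in>mon ` W. f x \<cdot> x) = 0" and "x \<in> mon ` W"
  then obtain w where w: "w \<in> W" "x = mon w" by blast
  have "(\<Sum>x\<in>mon ` W. f x \<cdot> x) = (\<Sum>u\<in>W. f (mon u) \<cdot> mon u)"
    using inj_mon by (subst sum.reindex) (auto intro: inj_on_subset simp: o_def)
  with * have "Poly_Mapping.lookup (\<Sum>u\<in>W. f (mon u) \<cdot> mon u) (Word w) = 0" by simp
  moreover have "Poly_Mapping.lookup (\<Sum>u\<in>W. f (mon u) \<cdot> mon u) (Word w) = f (mon w)"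
    using w assms by (simp add: lookup_sum lookup_single when_def if_distrib cong: if_cong)
  ultimately show "f x = 0" using w by simp
qed

lemma dim_hom_part: "fa.dim (hom_part m :: 'k::field free_poly set) = 2 ^ m"
proof -
  have "fa.dim (hom_part m :: 'k free_poly set) = card (mon ` words m :: 'k free_poly set)"
    unfolding span_words[symmetric]
    by (rule fa.dim_span_eq_card_independent) (simp add: independent_mons)
  also have "\<dots> = 2 ^ m"
    using inj_mon card_words by (metis card_image inj_on_subset subset_UNIV)
  finally show ?thesis .
qed

lemma homogeneous_sandwich:
  assumes "homogeneous m p"
  shows "homogeneous (length u + m + length v) (mon u * p * mon v)"
  unfolding homogeneous_alt
proof (intro allI impI)
  fix l :: "letter list" assume l: "length l \<noteq> length u + m + length v"
  show "Poly_Mapping.lookup (mon u * p * mon v) (Word l) = 0"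
  proof (cases "\<exists>s. l = s @ v")
    case True
    then obtain s where s: "l = s @ v" by blast
    show ?thesis
    proof (cases "\<exists>t. s = u @ t")
      case True
      then obtain t where t: "s = u @ t" by blast
      have "Poly_Mapping.lookup p (Word t) = 0"
        using assms l by (auto simp: homogeneous_alt s t)
      then show ?thesis unfolding s t lookup_mult_mon lookup_mon_mult .
    next
      case False
      then show ?thesis unfolding s lookup_mult_mon by (intro lookup_mon_mult_zero) auto
    qed
  next
    case False
    then show ?thesis by (intro lookup_mult_mon_zero) auto
  qed
qed

lemma supported_in_span:
  assumes "\<And>s. Poly_Mapping.lookup p (Word s) \<noteq> 0 \<Longrightarrow> s \<in> S"
  shows "p \<in> fa.span (mon ` S)"
proof -
  have "Poly_Mapping.lookup p w \<cdot> monomial w \<in> fa.span (mon ` S)"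
    if "w \<in> Poly_Mapping.keys p" for w
    using that assms[of "letters w"]
    by (intro fa.span_scale fa.span_base image_eqI[of _ _ "letters w"]) (auto simp: in_keys_iff)
  then show ?thesis
    by (subst expand_free_poly) (rule fa.span_sum)
qed

lemma independent_if_card_le_dim:
  assumes "finite S" "card S \<le> fa.dim (fa.span S)"
  shows "fa.independent S"
proof -
  obtain B where B: "B \<subseteq> S" "fa.independent B" "S \<subseteq> fa.span B"
    by (rule fa.maximal_independent_subset)
  then have "fa.span S = fa.span B"
    by (metis fa.span_minimal fa.span_mono fa.subspace_span subset_antisym)
  then have "card S \<le> card B"
    using assms B by (simp add: fa.dim_eq_card_independent)
  then have "B = S"
    using assms B by (intro card_seteq) auto
  with B show ?thesis by simp
qed

lemma span_if_dim_le_card: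
  assumes "B \<subseteq> V" "fa.independent B" "fa.dim V \<le> card B" "fa.dim V > 0"
  shows "V \<subseteq> fa.span B"
proof -
  obtain C where C: "B \<subseteq> C" "C \<subseteq> V" "fa.independent C" "V \<subseteq> fa.span C"
    using assms by (meson fa.maximal_independent_subset_extend)
  then have "card C = fa.dim V" by (simp add: fa.basis_card_eq_dim)
  with assms have "finite C" "card C \<le> card B" by (auto intro: card_ge_0_finite)
  then have "B = C" using C by (intro card_seteq) auto
  with C show ?thesis by simp
qed

section \<open>Derivatives of a potential\<close>

lemma lookup_linear_extension:
  "Poly_Mapping.lookup (linear_extension f p) s =
    (\<Sum>w\<in>Poly_Mapping.keys p. Poly_Mapping.lookup p w * Poly_Mapping.lookup (f w) s)"
  unfolding linear_extension_def fscale_def[symmetric] by (simp add: lookup_sum)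

lemma lookup_partial [simp]:
  "Poly_Mapping.lookup (partial z p) (Word s) = Poly_Mapping.lookup p (Word (z # s))"
proof -
  have "Poly_Mapping.lookup (partial z p) (Word s) =
    (\<Sum>w\<in>Poly_Mapping.keys p. if w = Word (z # s) then Poly_Mapping.lookup p w else 0)"
    unfolding partial_def lookup_linear_extension
  proof (intro sum.cong refl)
    fix w
    show "Poly_Mapping.lookup p w * Poly_Mapping.lookup (case letters w of [] \<Rightarrow> 0
        | a # u \<Rightarrow> if a = z then monomial (Word u) else 0) (Word s) =
      (if w = Word (z # s) then Poly_Mapping.lookup p w else 0)"
      by (cases w) (auto split: list.split simp: lookup_single when_def)
  qed
  also have "\<dots> = Poly_Mapping.lookup p (Word (z # s))"
    by (simp add: sum.delta in_keys_iff)
  finally show ?thesis .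
qed

lemma lookup_cyclic_shift:
  "Poly_Mapping.lookup (cyclic_shift p) (Word (s @ [z])) = Poly_Mapping.lookup p (Word (z # s))"
proof -
  have *: "rotate1 l = s @ [z] \<longleftrightarrow> l = z # s" for l
    by (cases l) auto
  have "Poly_Mapping.lookup (cyclic_shift p) (Word (s @ [z])) =
    (\<Sum>w\<in>Poly_Mapping.keys p. if w = Word (z # s) then Poly_Mapping.lookup p w else 0)"
    unfolding cyclic_shift_def lookup_linear_extension
  proof (intro sum.cong refl)
    fix w show "Poly_Mapping.lookup p w *
        Poly_Mapping.lookup (mon (rotate1 (letters w))) (Word (s @ [z])) =
        (if w = Word (z # s) then Poly_Mapping.lookup p w else 0)"
      by (cases w) (auto simp: lookup_single when_def *)
  qed
  also have "\<dots> = Poly_Mapping.lookup p (Word (z # s))"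
    by (simp add: sum.delta in_keys_iff)
  finally show ?thesis .
qed

lemma lookup_cyclic_shift_Nil:
  "Poly_Mapping.lookup (cyclic_shift p) (Word []) = Poly_Mapping.lookup p (Word [])"
proof -
  have "Poly_Mapping.lookup (cyclic_shift p) (Word []) =
    (\<Sum>w\<in>Poly_Mapping.keys p. if w = Word [] then Poly_Mapping.lookup p w else 0)"
    unfolding cyclic_shift_def lookup_linear_extension
  proof (intro sum.cong refl)
    fix w show "Poly_Mapping.lookup p w *
        Poly_Mapping.lookup (mon (rotate1 (letters w))) (Word []) =
        (if w = Word [] then Poly_Mapping.lookup p w else 0)"
      by (cases w) (auto simp: lookup_single when_def)
  qed
  then show ?thesis by (simp add: sum.delta in_keys_iff)
qed

lemma potential_iff:
  "potential F \<longleftrightarrow>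
    (\<forall>z s. Poly_Mapping.lookup F (Word (s @ [z])) = Poly_Mapping.lookup F (Word (z # s)))"
proof
  assume "potential F"
  then show "\<forall>z s. Poly_Mapping.lookup F (Word (s @ [z])) = Poly_Mapping.lookup F (Word (z # s))"
    unfolding potential_def by (metis lookup_cyclic_shift)
next
  assume *: "\<forall>z s. Poly_Mapping.lookup F (Word (s @ [z])) = Poly_Mapping.lookup F (Word (z # s))"
  show "potential F"
    unfolding potential_def
  proof (rule free_poly_eqI)
    fix s show "Poly_Mapping.lookup (cyclic_shift F) (Word s) = Poly_Mapping.lookup F (Word s)"
      by (cases s rule: rev_exhaust) (simp_all add: * lookup_cyclic_shift lookup_cyclic_shift_Nil)
  qed
qed

lemma homogeneous_partial:
  "homogeneous (Suc n) F \<Longrightarrow> homogeneous n (partial z F)"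
  by (simp add: homogeneous_alt)

text \<open>
  Up to the constant term, both sides are \<open>F\<close>: splitting off the first letter of every word gives the
  left-hand side, and by cyclic invariance splitting off the last letter gives the right-hand side.
\<close>

lemma potential_syzygy:
  assumes "potential F"
  shows "mon [Lx] * partial Lx F + mon [Ly] * partial Ly F =
    partial Lx F * mon [Lx] + partial Ly F * mon [Ly]"
proof (rule free_poly_eqI)
  fix s
  have L: "Poly_Mapping.lookup (mon [z] * p) (Word (a # t)) =
      (if a = z then Poly_Mapping.lookup p (Word t) else 0)" for z a t and p :: "'a free_poly"
    using lookup_mon_mult[of "[z]" p t] lookup_mon_mult_zero[of "a # t" "[z]"] by auto
  have R: "Poly_Mapping.lookup (p * mon [z]) (Word (t @ [a])) =
      (if a = z then Poly_Mapping.lookup p (Word t) else 0)" for z a t and p :: "'a free_poly"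
    using lookup_mult_mon[of p "[z]" t] lookup_mult_mon_zero[of "t @ [a]" "[z]"] by auto
  show "Poly_Mapping.lookup (mon [Lx] * partial Lx F + mon [Ly] * partial Ly F) (Word s) =
      Poly_Mapping.lookup (partial Lx F * mon [Lx] + partial Ly F * mon [Ly]) (Word s)"
  proof (cases s)
    case Nil
    then show ?thesis
      by (simp add: lookup_add lookup_mon_mult_zero lookup_mult_mon_zero)
  next
    case (Cons a t)
    then have "s = butlast s @ [last s]" by simp
    then obtain b u where u: "s = u @ [b]" by blast
    have "Poly_Mapping.lookup (mon [Lx] * partial Lx F + mon [Ly] * partial Ly F) (Word s) =
        Poly_Mapping.lookup F (Word s)"
      using Cons by (cases a) (simp_all add: lookup_add L)
    moreover have "Poly_Mapping.lookup (partial Lx F * mon [Lx] + partial Ly F * mon [Ly]) (Word s) =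
        Poly_Mapping.lookup F (Word s)"
      using assms u by (cases b) (simp_all add: lookup_add R potential_iff)
    ultimately show ?thesis by simp
  qed
qed

section \<open>The homogeneous parts of the ideal\<close>

text \<open>
  The number \<open>n\<close> is the degree of the derivatives; it is a parameter because the zero potential,
  which is homogeneous of every degree, does not determine it.
\<close>

definition multiples :: "nat \<Rightarrow> 'k::field free_poly \<Rightarrow> nat \<Rightarrow> 'k free_poly set" where
  "multiples n G m = {mon u * partial z G * mon v | u z v. length u + n + length v = m}"

lemma multiplesI:
  "length u + n + length v = m \<Longrightarrow> mon u * partial z G * mon v \<in> multiples n G m"
  unfolding multiples_def by blast

abbreviation ideal_part :: "nat \<Rightarrow> 'k::field free_poly \<Rightarrow> nat \<Rightarrow> 'k free_poly set" where
  "ideal_part n G m \<equiv> fa.span (multiples n G m)"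

lemma ideal_part_lmult:
  assumes "p \<in> ideal_part n G m"
  shows "mon s * p \<in> ideal_part n G (length s + m)"
  using assms
proof (rule span_lmult_closed)
  fix q assume "q \<in> multiples n G m"
  then obtain u z v where "q = mon u * partial z G * mon v" "length u + n + length v = m"
    unfolding multiples_def by blast
  then have "mon s * q = mon (s @ u) * partial z G * mon v"
    "length (s @ u) + n + length v = length s + m"
    by (simp_all add: mult.assoc)
  then have "mon s * q \<in> multiples n G (length s + m)"
    unfolding multiples_def by blast
  then show "mon s * q \<in> ideal_part n G (length s + m)"
    by (rule fa.span_base)
qed

lemma ideal_part_subset_hom_part:
  assumes "homogeneous (Suc n) G"
  shows "ideal_part n G m \<subseteq> hom_part m"
proof (rule fa.span_minimal[OF _ subspace_hom_part])
  show "multiples n G m \<subseteq> hom_part m"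
    unfolding multiples_def using homogeneous_sandwich[OF homogeneous_partial[OF assms]] by auto
qed

definition component :: "nat \<Rightarrow> 'k::field free_poly \<Rightarrow> 'k free_poly" where
  "component m p = (\<Sum>w\<in>{w \<in> Poly_Mapping.keys p. length (letters w) = m}.
     Poly_Mapping.lookup p w \<cdot> monomial w)"

lemma lookup_component [simp]:
  "Poly_Mapping.lookup (component m p) (Word l) =
    (if length l = m then Poly_Mapping.lookup p (Word l) else 0)"
  by (simp add: component_def lookup_sum lookup_single when_def if_distrib in_keys_iff cong: if_cong)

lemma component_add: "component m (p + q) = component m p + component m q"
  by (rule free_poly_eqI) (simp add: lookup_add)

lemma component_fscale: "component m (c \<cdot> p) = c \<cdot> component m p"
  by (rule free_poly_eqI) simp

lemma component_homogeneous:
  "homogeneous k p \<Longrightarrow> component m p = (if k = m then p else 0)"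
  by (rule free_poly_eqI) (auto simp: homogeneous_alt)

lemma component_zero [simp]: "component m 0 = 0"
  by (rule free_poly_eqI) simp

lemma ring_free_alg: "ring (free_alg :: 'k::field free_poly ring)"
proof -
  have "\<exists>y. x + y = 0" for x :: "'k free_poly"
    using add.right_inverse by blast
  then show ?thesis
    unfolding ring_of_type_algebra_def using add.right_inverse
    by unfold_locales (auto simp: algebra_simps Units_def)
qed

lemma free_alg_simps [simp]:
  "carrier free_alg = UNIV" "p \<otimes>\<^bsub>free_alg\<^esub> q = p * q" "p \<oplus>\<^bsub>free_alg\<^esub> q = p + q"
  "\<zero>\<^bsub>free_alg\<^esub> = 0" "\<one>\<^bsub>free_alg\<^esub> = 1"
  by (simp_all add: ring_of_type_algebra_def)

lemma ideal_potential_ideal: "ideal (potential_ideal F) free_alg"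
  unfolding potential_ideal_def
  by (intro ring.genideal_ideal ring_free_alg) simp

text \<open>
  Multipliers \<open>a\<close> and \<open>b\<close> are expanded into words, one side at a time.
\<close>

lemma mult_in_span_multiples:
  assumes "p \<in> fa.span {mon u * partial z F * mon v | u z v. True}"
  shows "a * p * b \<in> fa.span {mon u * partial z F * mon v | u z v. True}" (is "_ \<in> ?S")
proof -
  have *: "monomial s * p * monomial t \<in> ?S" for s t
    using assms
  proof (rule span_mult_closed)
    fix q assume "q \<in> {mon u * partial z F * mon v | u z v. True}"
    then obtain u z v where q: "q = mon u * partial z F * mon v" by blast
    have "monomial s * q * monomial t = mon (letters s @ u) * partial z F * mon (v @ letters t)"
      unfolding q by (cases s, cases t) (simp add: mult.assoc)
    then show "monomial s * q * monomial t \<in> ?S"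
      by (intro fa.span_base) blast
  qed
  have "a * p * monomial t \<in> ?S" for t
  proof -
    have "a * p * monomial t = (\<Sum>s\<in>Poly_Mapping.keys a.
        Poly_Mapping.lookup a s \<cdot> (monomial s * p * monomial t))"
      by (subst expand_free_poly[of a]) (simp add: sum_distrib_right fscale_mult_left)
    then show ?thesis using * by (auto intro!: fa.span_sum fa.span_scale)
  qed
  moreover have "a * p * b = (\<Sum>t\<in>Poly_Mapping.keys b.
        Poly_Mapping.lookup b t \<cdot> (a * p * monomial t))"
      by (subst expand_free_poly[of b]) (simp add: sum_distrib_left fscale_mult_right)
  ultimately show ?thesis by (auto intro!: fa.span_sum fa.span_scale)
qed

lemma potential_ideal_eq_span:
  "potential_ideal F = fa.span {mon u * partial z F * mon v | u z v. True}" (is "_ = ?S")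
proof
  interpret F: ring "free_alg :: 'a free_poly ring" by (rule ring_free_alg)
  interpret I: ideal "potential_ideal F" free_alg by (rule ideal_potential_ideal)
  have gen: "partial z F \<in> potential_ideal F" for z
    unfolding potential_ideal_def by (cases z) (auto intro: F.genideal_self[THEN subsetD])
  have "fa.subspace (potential_ideal F)"
  proof (rule fa.subspaceI)
    show "0 \<in> potential_ideal F" using additive_subgroup.zero_closed[OF I.is_additive_subgroup] by simp
    show "x + y \<in> potential_ideal F" if "x \<in> potential_ideal F" "y \<in> potential_ideal F" for x y
      using additive_subgroup.a_closed[OF I.is_additive_subgroup that] by simp
    show "c \<cdot> x \<in> potential_ideal F" if "x \<in> potential_ideal F" for c x
      using I.I_l_closed[OF that, of "scalar c"] by (simp add: fscale_def)
  qed
  moreover have "mon u * partial z F * mon v \<in> potential_ideal F" for u z v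
    using I.I_r_closed[OF I.I_l_closed[OF gen, of "mon u"], of "mon v"] by simp
  ultimately show "?S \<subseteq> potential_ideal F"
    by (intro fa.span_minimal) auto
  have "ideal ?S free_alg"
  proof (rule idealI[OF ring_free_alg])
    show "subgroup ?S (add_monoid free_alg)"
    proof (rule group.subgroupI)
      show "group (add_monoid (free_alg :: 'a free_poly ring))"
        by (rule F.a_group)
      show "inv\<^bsub>add_monoid free_alg\<^esub> a \<in> ?S" if "a \<in> ?S" for a
      proof -
        have "inv\<^bsub>add_monoid free_alg\<^esub> a = - a"
          unfolding a_inv_def [symmetric] by (rule F.minus_equality) simp_all
        then show ?thesis using that by (simp add: fa.span_neg)
      qed
    qed (auto simp: fa.span_add intro: fa.span_zero)
    show "x \<otimes>\<^bsub>free_alg\<^esub> a \<in> ?S" "a \<otimes>\<^bsub>free_alg\<^esub> x \<in> ?S" if "a \<in> ?S" for a x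
      using mult_in_span_multiples[OF that, of x 1] mult_in_span_multiples[OF that, of 1 x] by simp_all
  qed
  moreover have "partial z F \<in> ?S" for z
    by (intro fa.span_base) (use mon_Nil in \<open>metis (mono_tags, lifting) mem_Collect_eq mult_1 mult.right_neutral\<close>)
  ultimately show "potential_ideal F \<subseteq> ?S"
    unfolding potential_ideal_def by (intro F.genideal_minimal) auto
qed

text \<open>
  The ideal is homogeneous: a spanning element \<open>u r v\<close> is itself homogeneous, so each of its components
  is either the element or zero.
\<close>

lemma component_potential_ideal:
  assumes "homogeneous (Suc n) F" "p \<in> potential_ideal F"
  shows "component m p \<in> ideal_part n F m"
  using assms(2) unfolding potential_ideal_eq_span
proof (induction rule: fa.span_induct_alt)
  case base
  then show ?case by (simp add: fa.span_zero)
next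
  case (step c x y)
  then obtain u z v where x: "x = mon u * partial z F * mon v" by blast
  have h: "homogeneous (length u + n + length v) x"
    unfolding x by (intro homogeneous_sandwich homogeneous_partial assms)
  have "component m x \<in> ideal_part n F m"
  proof (cases "length u + n + length v = m")
    case True
    then have "x \<in> multiples n F m" unfolding multiples_def x by blast
    then show ?thesis using True component_homogeneous[OF h] by (simp add: fa.span_base)
  next
    case False
    then show ?thesis using component_homogeneous[OF h] by (simp add: fa.span_zero)
  qed
  with step show ?case by (simp add: component_add component_fscale fa.span_add fa.span_scale)
qed

lemma ideal_part_eq:
  assumes "homogeneous (Suc n) F"
  shows "ideal_part n F m = potential_ideal F \<inter> hom_part m"
proof
  have "ideal_part n F m \<subseteq> potential_ideal F"
    unfolding potential_ideal_eq_span multiples_def by (intro fa.span_mono) auto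
  then show "ideal_part n F m \<subseteq> potential_ideal F \<inter> hom_part m"
    using ideal_part_subset_hom_part[OF assms] by blast
  show "potential_ideal F \<inter> hom_part m \<subseteq> ideal_part n F m"
  proof
    fix p assume "p \<in> potential_ideal F \<inter> hom_part m"
    then show "p \<in> ideal_part n F m"
      using component_potential_ideal[OF assms, of p m] component_homogeneous[of m p m] by simp
  qed
qed

section \<open>Normal words\<close>

text \<open>
  The word to be rewritten by the derivative with respect to the given letter. Both words have length
  \<open>n\<close>, and they overlap in the single word \<open>x^(n-1) y y\<close>. Neither begins with \<open>y\<close>, so a normal word
  stays normal when \<open>y\<close> is put in front.
\<close>

fun leading_word :: "nat \<Rightarrow> letter \<Rightarrow> letter list" where
  "leading_word n Lx = replicate (n - 2) Lx @ [Ly, Ly]"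
| "leading_word n Ly = replicate (n - 1) Lx @ [Ly]"

declare leading_word.simps [simp del]

lemma ge_3_Suc: "n \<ge> 3 \<Longrightarrow> \<exists>k. n = Suc (Suc (Suc k))"
  by (intro exI[of _ "n - 3"]) simp

lemma length_leading_word: "n \<ge> 2 \<Longrightarrow> length (leading_word n z) = n"
  by (cases z) (auto simp: leading_word.simps)

primrec normal_word :: "nat \<Rightarrow> letter list \<Rightarrow> bool" where
  "normal_word n [] \<longleftrightarrow> True"
| "normal_word n (a # l) \<longleftrightarrow> normal_word n l \<and> (\<forall>z. take n (a # l) \<noteq> leading_word n z)"

abbreviation normal_words :: "nat \<Rightarrow> nat \<Rightarrow> letter list set" where
  "normal_words n m \<equiv> {l \<in> words m. normal_word n l}"

abbreviation reducible_words :: "nat \<Rightarrow> nat \<Rightarrow> letter list set" where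
  "reducible_words n m \<equiv> {l \<in> words m. \<not> normal_word n l}"

lemma card_reducible_words:
  "card (reducible_words n m) = 2 ^ m - card (normal_words n m)"
proof -
  have "reducible_words n m = words m - normal_words n m" by auto
  then show ?thesis using card_words[of m] by (simp add: card_Diff_subset)
qed

lemma card_normal_words_le: "card (normal_words n m) \<le> 2 ^ m"
  unfolding card_words[of m, symmetric] by (intro card_mono) auto

lemma leading_word_inj: "n \<ge> 2 \<Longrightarrow> leading_word n z = leading_word n z' \<longleftrightarrow> z = z'"
proof -
  assume "n \<ge> 2"
  then obtain k where k: "n = Suc (Suc k)" by (metis add_2_eq_Suc le_Suc_ex)
  have "leading_word n Lx ! k \<noteq> leading_word n Ly ! k"
    by (simp add: k leading_word.simps nth_append del: replicate_Suc)
  then have "leading_word n Lx \<noteq> leading_word n Ly" by metis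
  then show ?thesis by (cases z; cases z') auto
qed

lemma leading_word_eq_Cons: "n \<ge> 3 \<Longrightarrow> leading_word n z = Lx # tl (leading_word n z)"
  using ge_3_Suc[of n] by (cases z) (auto simp: leading_word.simps)

lemma normal_Ly: "n \<ge> 3 \<Longrightarrow> normal_word n (Ly # l) \<longleftrightarrow> normal_word n l"
  using leading_word_eq_Cons[of n] by (cases n) (auto, metis letter.distinct(1) list.inject)

lemma normal_replicate_short:
  assumes "k + 3 \<le> n"
  shows "normal_word n (replicate k Lx @ Ly # l) \<longleftrightarrow> normal_word n l"
  using assms
proof (induction k)
  case (Suc k)
  have "take n (Lx # replicate k Lx @ Ly # l) \<noteq> leading_word n z" for z
  proof
    assume *: "take n (Lx # replicate k Lx @ Ly # l) = leading_word n z"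
    have "take n (Lx # replicate k Lx @ Ly # l) ! Suc k = Ly"
      using Suc.prems by (simp add: nth_append)
    moreover have "leading_word n z ! Suc k = Lx"
      using Suc.prems less_diff_conv[of "Suc k" n 2] less_diff_conv[of "Suc k" n 1]
      by (cases z) (simp_all add: leading_word.simps nth_append)
    ultimately show False using * by simp
  qed
  with Suc show ?case by simp
qed (simp add: normal_Ly del: normal_word.simps)

lemma take_eq_leading_word_iff:
  assumes "n \<ge> 2"
  shows "take n l = leading_word n z \<longleftrightarrow> (\<exists>w. l = leading_word n z @ w)"
proof
  assume "take n l = leading_word n z"
  then have "l = leading_word n z @ drop n l" using append_take_drop_id[of n l] by simp
  then show "\<exists>w. l = leading_word n z @ w" by blast
next
  assume "\<exists>w. l = leading_word n z @ w"
  then show "take n l = leading_word n z" using length_leading_word[OF assms, of z] by auto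
qed

lemma tl_leading_word:
  assumes "n \<ge> 3"
  shows "tl (leading_word n Lx) = replicate (n - 3) Lx @ [Ly, Ly]" "tl (leading_word n Ly) = replicate (n - 2) Lx @ [Ly]"
proof -
  obtain k where "n = Suc (Suc (Suc k))"
    using ge_3_Suc[OF assms] by blast
  then show "tl (leading_word n Lx) = replicate (n - 3) Lx @ [Ly, Ly]"
    "tl (leading_word n Ly) = replicate (n - 2) Lx @ [Ly]"
    by (simp_all add: leading_word.simps)
qed

text \<open>
  The next two lemmas determine the words \<open>w\<close> that can follow the last leading word inside a reducible
  word. After \<open>x^(n-2) y y\<close> every normal \<open>w\<close> is possible; after \<open>x^(n-1) y\<close> the word \<open>w\<close> must not begin
  with \<open>y\<close>, since otherwise a second leading word \<open>x^(n-2) y y\<close> starts one letter later.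
\<close>

lemma normal_tl_leading_word_Lx:
  assumes "n \<ge> 3"
  shows "normal_word n (tl (leading_word n Lx) @ w) \<longleftrightarrow> normal_word n w"
  using normal_replicate_short[of "n - 3" n "Ly # w"] normal_Ly[OF assms, of w] assms
  by (simp add: tl_leading_word del: normal_word.simps)

lemma normal_tl_leading_word_Ly:
  assumes "n \<ge> 3"
  shows "normal_word n (tl (leading_word n Ly) @ w) \<longleftrightarrow> normal_word n w \<and> (\<forall>w'. w \<noteq> Ly # w')"
proof -
  obtain k where k: "n = Suc (Suc (Suc k))"
    using ge_3_Suc[OF assms] by blast
  have 1: "replicate (Suc k) Lx @ Ly # w \<noteq> leading_word n Ly @ v" for v
  proof
    assume "replicate (Suc k) Lx @ Ly # w = leading_word n Ly @ v"
    then have "(replicate (Suc k) Lx @ Ly # w) ! Suc k = (leading_word n Ly @ v) ! Suc k" by simp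
    then show False by (simp add: k leading_word.simps nth_append del: replicate_Suc)
  qed
  have 2: "(\<exists>v. replicate (Suc k) Lx @ Ly # w = leading_word n Lx @ v) \<longleftrightarrow> (\<exists>w'. w = Ly # w')"
    by (auto simp: k leading_word.simps)
  have "normal_word n (tl (leading_word n Ly) @ w) \<longleftrightarrow>
    normal_word n (replicate k Lx @ Ly # w) \<and> (\<forall>z. take n (replicate (Suc k) Lx @ Ly # w) \<noteq> leading_word n z)"
    using tl_leading_word[of n] by (simp add: k)
  also have "normal_word n (replicate k Lx @ Ly # w) \<longleftrightarrow> normal_word n w"
    by (rule normal_replicate_short) (simp add: k)
  also have "(\<forall>z. take n (replicate (Suc k) Lx @ Ly # w) \<noteq> leading_word n z) \<longleftrightarrow> (\<forall>w'. w \<noteq> Ly # w')"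
  proof -
    have "(\<exists>z. take n (replicate (Suc k) Lx @ Ly # w) = leading_word n z) \<longleftrightarrow>
      (\<exists>v. replicate (Suc k) Lx @ Ly # w = leading_word n Lx @ v) \<or>
      (\<exists>v. replicate (Suc k) Lx @ Ly # w = leading_word n Ly @ v)"
      using assms by (subst take_eq_leading_word_iff) (auto, metis letter.exhaust)
    with 1 2 show ?thesis by blast
  qed
  finally show ?thesis .
qed

lemma reducible_leading_word_append:
  assumes "n \<ge> 3"
  shows "\<not> normal_word n (leading_word n z @ w)"
proof -
  obtain a l where l: "leading_word n z @ w = a # l"
    using leading_word_eq_Cons[OF assms, of z] by (metis append_Cons)
  have "take n (a # l) = leading_word n z"
    unfolding l[symmetric] using length_leading_word[of n z] assms by simp
  then show ?thesis unfolding l by auto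
qed

section \<open>A spanning set of the ideal indexed by the reducible words\<close>

text \<open>
  In a reducible word \<open>u L w\<close>, with \<open>L\<close> its last leading word, the factor \<open>L\<close> is replaced by
  the corresponding derivative; normal words are kept. Thus the reducible words index elements of the
  ideal, and the normal words index candidates for a basis of a complement.
\<close>

primrec adapted :: "nat \<Rightarrow> 'k::field free_poly \<Rightarrow> letter list \<Rightarrow> 'k free_poly" where
  "adapted n G [] = 1"
| "adapted n G (a # l) =
    (if \<not> normal_word n l then mon [a] * adapted n G l
     else if take n (a # l) = leading_word n Lx then partial Lx G * mon (drop n (a # l))
     else if take n (a # l) = leading_word n Ly then partial Ly G * mon (drop n (a # l))
     else mon (a # l))"

lemma adapted_normal: "normal_word n l \<Longrightarrow> adapted n G l = mon l"
  by (cases l) auto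

lemma adapted_leading_word:
  assumes "n \<ge> 3" "normal_word n (tl (leading_word n z) @ w)"
  shows "adapted n G (leading_word n z @ w) = partial z G * mon w"
proof -
  have eq: "leading_word n z @ w = Lx # (tl (leading_word n z) @ w)"
    using leading_word_eq_Cons[OF assms(1), of z] by (metis append_Cons)
  have "take n (Lx # (tl (leading_word n z) @ w)) = leading_word n z" "drop n (Lx # (tl (leading_word n z) @ w)) = w"
    unfolding eq[symmetric] using length_leading_word[of n z] assms(1) by simp_all
  with assms show ?thesis unfolding eq adapted.simps
    using leading_word_inj[of n Lx Ly] by (cases z) auto
qed

lemma adapted_in_ideal_part:
  assumes "n \<ge> 3" "\<not> normal_word n l"
  shows "adapted n G l \<in> ideal_part n G (length l)"
  using assms(2)
proof (induction l)
  case (Cons a l)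
  show ?case
  proof (cases "normal_word n l")
    case False
    then show ?thesis using Cons.IH ideal_part_lmult[of "adapted n G l" n G "length l" "[a]"] by simp
  next
    case True
    with Cons.prems obtain z where "take n (a # l) = leading_word n z" by auto
    then obtain w where w: "a # l = leading_word n z @ w"
      using take_eq_leading_word_iff[of n "a # l" z] assms by auto
    have "l = tl (leading_word n z) @ w"
      using w leading_word_eq_Cons[OF assms(1), of z] by (metis append_Cons list.inject)
    with True have "adapted n G (a # l) = partial z G * mon w"
      unfolding w using adapted_leading_word[OF assms(1)] by simp
    moreover have "length (a # l) = n + length w"
      unfolding w using length_leading_word assms by simp
    ultimately have "adapted n G (a # l) \<in> multiples n G (length (a # l))"
      using multiplesI[of "[]" n w "length (a # l)" z G] by simp
    then show ?thesis by (rule fa.span_base)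
  qed
qed simp

lemma adapted_homogeneous:
  assumes "n \<ge> 3" "homogeneous (Suc n) G"
  shows "adapted n G l \<in> hom_part (length l)"
  using adapted_normal[of n l G] adapted_in_ideal_part[OF assms(1), of l G]
    ideal_part_subset_hom_part[OF assms(2)] by (cases "normal_word n l") auto

abbreviation reducible_span :: "nat \<Rightarrow> 'k::field free_poly \<Rightarrow> nat \<Rightarrow> 'k free_poly set" where
  "reducible_span n G m \<equiv> fa.span (adapted n G ` reducible_words n m)"

lemma reducible_span_lmult:
  assumes "p \<in> reducible_span n G m"
  shows "mon [a] * p \<in> reducible_span n G (Suc m)"
  using assms
proof (rule span_lmult_closed)
  fix q assume "q \<in> adapted n G ` reducible_words n m"
  then obtain l where l: "q = adapted n G l" "l \<in> reducible_words n m" by blast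
  then have "mon [a] * q = adapted n G (a # l)" "a # l \<in> reducible_words n (Suc m)"
    by (auto simp: words_def)
  then have "mon [a] * q \<in> adapted n G ` reducible_words n (Suc m)"
    by (intro image_eqI)
  then show "mon [a] * q \<in> reducible_span n G (Suc m)" by (rule fa.span_base)
qed

text \<open>
  By induction on the degree. Elements \<open>a p\<close> with \<open>p\<close> in the ideal and \<open>a\<close> a letter are covered by the
  induction hypothesis, which leaves \<open>r\<^sub>z p\<close> with \<open>p\<close> arbitrary. By the spanning hypothesis \<open>p\<close> may be
  taken to be an adapted element. If \<open>p\<close> is in the ideal, then each term of \<open>r\<^sub>z\<close> has a first letter to
  split off, and the induction hypothesis applies again. If \<open>p\<close> is a normal word, then \<open>r\<^sub>z p\<close> is an
  adapted element except when \<open>z = y\<close> and \<open>p = y w'\<close>. In that case the syzygy rewrites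
  \<open>r\<^sub>y y w'\<close> as \<open>x r\<^sub>x w' + y r\<^sub>y w' - r\<^sub>x x w'\<close>, whose summands have all been treated.
\<close>

lemma ideal_part_subset_reducible_span:
  assumes n: "n \<ge> 3" and G: "potential G" "homogeneous (Suc n) G"
    and spans: "\<And>k. hom_part k \<subseteq> fa.span (adapted n G ` words k)"
  shows "ideal_part n G m \<subseteq> reducible_span n G m"
proof (induction m)
  case 0
  have "multiples n G 0 = {}" using n by (auto simp: multiples_def)
  then show ?case by (simp add: fa.span_zero)
next
  case (Suc m)
  have left: "mon [a] * p \<in> reducible_span n G (Suc m)" if "p \<in> ideal_part n G m" for a p
    using that Suc by (intro reducible_span_lmult) auto
  \<comment> \<open>reduction from an arbitrary right factor to a normal word\<close>
  have *: "partial z G * p \<in> reducible_span n G (Suc m)"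
    if "p \<in> hom_part k" "n + k = Suc m" and
      mon: "\<And>w. normal_word n w \<Longrightarrow> length w = k \<Longrightarrow> partial z G * mon w \<in> reducible_span n G (Suc m)"
    for z p k
  proof -
    have "p \<in> fa.span (adapted n G ` words k)" using that spans by blast
    then show ?thesis
    proof (rule span_lmult_closed)
      fix q assume "q \<in> adapted n G ` words k"
      then obtain w where w: "q = adapted n G w" "length w = k" by (auto simp: words_def)
      show "partial z G * q \<in> reducible_span n G (Suc m)"
      proof (cases "normal_word n w")
        case True
        with w mon show ?thesis by (simp add: adapted_normal)
      next
        case False
        have "partial z G \<in> fa.span (mon ` words n)"
          unfolding span_words using homogeneous_partial[OF G(2)] by simp
        then show ?thesis
        proof (rule span_rmult_closed)
          fix s assume "s \<in> (mon ` words n :: 'a free_poly set)"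
          then obtain l where l: "s = mon l" "length l = n" by (auto simp: words_def)
          then obtain a l' where l': "l = a # l'" using n by (cases l) auto
          have "mon l' * q \<in> ideal_part n G (length l' + k)"
            using False w adapted_in_ideal_part[OF n, of w G] by (auto intro: ideal_part_lmult)
          moreover have "length l' + k = m" using l l' that by simp
          ultimately have "mon [a] * (mon l' * q) \<in> reducible_span n G (Suc m)"
            by (intro left) simp
          then show "s * q \<in> reducible_span n G (Suc m)" by (simp add: l l')
        qed
      qed
    qed
  qed
  have leading: "partial z G * mon w \<in> reducible_span n G (Suc m)"
    if "normal_word n (tl (leading_word n z) @ w)" "n + length w = Suc m" for z w
  proof -
    have "leading_word n z @ w \<in> reducible_words n (Suc m)"
      using reducible_leading_word_append[OF n] that length_leading_word[of n z] n by (simp add: words_def)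
    then show ?thesis
      unfolding adapted_leading_word[OF n that(1), of G, symmetric] by (intro fa.span_base imageI)
  qed
  have x: "partial Lx G * p \<in> reducible_span n G (Suc m)" if "p \<in> hom_part k" "n + k = Suc m" for p k
    using that by (rule *) (use that n in \<open>auto intro!: leading simp: normal_tl_leading_word_Lx\<close>)
  have y: "partial Ly G * p \<in> reducible_span n G (Suc m)" if "p \<in> hom_part k" "n + k = Suc m" for p k
    using that
  proof (rule *)
    fix w assume w: "normal_word n w" "length w = k"
    show "partial Ly G * mon w \<in> reducible_span n G (Suc m)"
    proof (cases "\<exists>w'. w = Ly # w'")
      case False
      with w that n show ?thesis by (auto intro!: leading simp: normal_tl_leading_word_Ly)
    next
      case True
      then obtain w' where w': "w = Ly # w'" by blast
      \<comment> \<open>the one case that needs the potential\<close>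
      have yy: "partial Ly G * mon [Ly] = mon [Lx] * partial Lx G + mon [Ly] * partial Ly G
          - partial Lx G * mon [Lx]"
        using potential_syzygy[OF G(1)] by (simp add: algebra_simps)
      have "partial Ly G * mon w = (partial Ly G * mon [Ly]) * mon w'"
        by (simp add: w' mult.assoc)
      also have "\<dots> = mon [Lx] * (partial Lx G * mon w')
          + mon [Ly] * (partial Ly G * mon w') - partial Lx G * mon (Lx # w')"
        unfolding yy by (simp add: left_diff_distrib distrib_right mult.assoc)
      finally have "partial Ly G * mon w = mon [Lx] * (partial Lx G * mon w')
          + mon [Ly] * (partial Ly G * mon w') - partial Lx G * mon (Lx # w')" .
      moreover have "partial z G * mon w' \<in> ideal_part n G m" for z
      proof -
        have "partial z G * mon w' \<in> multiples n G m"
          using multiplesI[of "[]" n w' m z G] w w' that by simp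
        then show ?thesis by (rule fa.span_base)
      qed
      moreover have "partial Lx G * mon (Lx # w') \<in> reducible_span n G (Suc m)"
        using w w' that by (intro x[of _ k]) simp_all
      ultimately show ?thesis
        by (simp add: fa.span_add fa.span_diff left)
    qed
  qed
  have "multiples n G (Suc m) \<subseteq> reducible_span n G (Suc m)"
  proof
    fix q assume "q \<in> multiples n G (Suc m)"
    then obtain u z v where q: "q = mon u * partial z G * mon v" "length u + n + length v = Suc m"
      unfolding multiples_def by blast
    show "q \<in> reducible_span n G (Suc m)"
    proof (cases u)
      case Nil
      then show ?thesis using q x[of "mon v" "length v"] y[of "mon v" "length v"] by (cases z) simp_all
    next
      case (Cons a u')
      have "mon u' * partial z G * mon v \<in> multiples n G m"
        unfolding multiples_def using q Cons by auto
      then have "mon [a] * (mon u' * partial z G * mon v) \<in> reducible_span n G (Suc m)"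
        by (intro left fa.span_base)
      then show ?thesis by (simp add: q Cons mult.assoc)
    qed
  qed
  then show ?case by (intro fa.span_minimal) simp_all
qed

lemma dim_ideal_part_le:
  assumes "n \<ge> 3" "potential G" "homogeneous (Suc n) G"
    and "\<And>k. hom_part k \<subseteq> fa.span (adapted n G ` words k)"
  shows "fa.dim (ideal_part n G m) \<le> card (reducible_words n m)"
proof -
  have "fa.dim (ideal_part n G m) \<le> card (adapted n G ` reducible_words n m)"
    by (intro fa.dim_le_card ideal_part_subset_reducible_span assms) simp
  also have "\<dots> \<le> card (reducible_words n m)" by (intro card_image_le) simp
  finally show ?thesis .
qed

section \<open>The model potential, a sum of rotations\<close>

text \<open>
  The rotations of \<open>x^(n-1) y y\<close>: in one of them the two letters \<open>y\<close> are separated at the ends of the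
  word, in the \<open>n\<close> others they are adjacent.
\<close>

definition model_words :: "nat \<Rightarrow> letter list set" where
  "model_words n = insert (Ly # replicate (n - 1) Lx @ [Ly])
     ((\<lambda>i. replicate i Lx @ [Ly, Ly] @ replicate (n - 1 - i) Lx) ` {..<n})"

definition model_potential :: "nat \<Rightarrow> 'k::field free_poly" where
  "model_potential n = (\<Sum>l\<in>model_words n. mon l)"

lemma finite_model_words [simp]: "finite (model_words n)"
  by (simp add: model_words_def)

lemma lookup_model_potential [simp]:
  "Poly_Mapping.lookup (model_potential n) (Word l) = (if l \<in> model_words n then 1 else 0)"
  by (simp add: model_potential_def lookup_sum lookup_single when_def)

lemma homogeneous_model_potential: "n \<ge> 1 \<Longrightarrow> homogeneous (Suc n) (model_potential n)"
  by (auto simp: homogeneous_alt model_words_def)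

lemma rotate1_model_words: "rotate1 ` model_words n = model_words n"
proof (rule endo_inj_surj)
  show "inj_on rotate1 (model_words n)"
  proof (rule inj_onI)
    fix u v :: "letter list" assume "rotate1 u = rotate1 v"
    then show "u = v" by (cases u; cases v) auto
  qed
  show "rotate1 ` model_words n \<subseteq> model_words n"
  proof (rule image_subsetI)
    fix l assume "l \<in> model_words n"
    then consider "l = Ly # replicate (n - 1) Lx @ [Ly]"
      | i where "i < n" "l = replicate i Lx @ [Ly, Ly] @ replicate (n - 1 - i) Lx"
      unfolding model_words_def by blast
    then show "rotate1 l \<in> model_words n"
    proof cases
      case 1
      show ?thesis
      proof (cases n)
        case 0
        then show ?thesis using 1 by (simp add: model_words_def)
      next
        case (Suc m)
        have "rotate1 l = replicate m Lx @ [Ly, Ly] @ replicate (n - 1 - m) Lx" "m < n"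
          using 1 Suc by simp_all
        then show ?thesis unfolding model_words_def by blast
      qed
    next
      case 2
      show ?thesis
      proof (cases i)
        case 0
        then show ?thesis using 2 by (simp add: model_words_def)
      next
        case (Suc j)
        have "rotate1 l = replicate j Lx @ [Ly, Ly] @ replicate (n - 1 - i) Lx @ [Lx]"
          using 2 Suc by simp
        also have "replicate (n - 1 - i) Lx @ [Lx] = replicate (n - 1 - j) Lx"
        proof -
          have "n - 1 - j = Suc (n - 1 - i)" using 2 Suc by simp
          then show ?thesis by (simp only: replicate_append_same replicate_Suc)
        qed
        finally have "rotate1 l = replicate j Lx @ [Ly, Ly] @ replicate (n - 1 - j) Lx" "j < n"
          using 2 Suc by simp_all
        then show ?thesis unfolding model_words_def by blast
      qed
    qed
  qed
qed simp

lemma potential_model_potential: "potential (model_potential n)"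
proof -
  have "s @ [z] \<in> model_words n \<longleftrightarrow> z # s \<in> model_words n" for s z
  proof
    assume "z # s \<in> model_words n"
    then have "rotate1 (z # s) \<in> model_words n" using rotate1_model_words by blast
    then show "s @ [z] \<in> model_words n" by simp
  next
    assume "s @ [z] \<in> model_words n"
    then obtain t where t: "t \<in> model_words n" "s @ [z] = rotate1 t"
      using rotate1_model_words by blast
    then have "t = z # s" by (cases t) auto
    with t show "z # s \<in> model_words n" by simp
  qed
  then show ?thesis by (simp add: potential_iff)
qed

text \<open>
  The number of pairs of positions that carry \<open>x\<close> before \<open>y\<close>. It serves as a termination order.
\<close>

primrec inversions :: "letter list \<Rightarrow> nat" where
  "inversions [] = 0"
| "inversions (a # l) = (if a = Lx then count_list l Ly else 0) + inversions l"

lemma inversions_append: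
  "inversions (u @ v) = inversions u + inversions v + count_list u Lx * count_list v Ly"
  by (induction u) auto

text \<open>
  Fixing the numbers of both letters makes the comparison stable under multiplication by words: the
  inversions between two factors of a word depend only on the letter counts of the factors.
\<close>

definition smaller_words :: "letter list \<Rightarrow> letter list set" where
  "smaller_words l = {s. length s = length l \<and> count_list s Ly = count_list l Ly
     \<and> inversions s < inversions l}"

lemma count_list_Lx: "count_list l Lx = length l - count_list l Ly"
proof -
  have "count_list l Lx + count_list l Ly = length l"
  proof (induction l)
    case (Cons a l)
    then show ?case by (cases a) auto
  qed simp
  then show ?thesis by simp
qed

lemma smaller_words_append:
  assumes "s \<in> smaller_words l"
  shows "u @ s @ v \<in> smaller_words (u @ l @ v)"
  using assms count_list_Lx[of s] count_list_Lx[of l]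
  by (auto simp: smaller_words_def inversions_append)

lemma count_list_replicate_letter: "count_list (replicate k a) b = (if a = b then k else 0)"
  by (induction k) auto

lemma inversions_replicate [simp]: "inversions (replicate k Lx) = 0"
  by (induction k) (auto simp: count_list_replicate_letter)

text \<open>
  Besides its leading word, the derivative with respect to \<open>x\<close> consists of the words
  \<open>x^j y y x^(n-2-j)\<close> with \<open>j < n - 2\<close>, and the derivative with respect to \<open>y\<close> of \<open>y x^(n-1)\<close>. All
  coefficients are \<open>1\<close>, so the characteristic of the field does not matter.
\<close>

lemma partial_model_potential:
  assumes "n \<ge> 3"
  shows "partial z (model_potential n) - mon (leading_word n z) \<in> fa.span (mon ` smaller_words (leading_word n z))"
proof (rule supported_in_span)
  fix s
  assume *: "Poly_Mapping.lookup (partial z (model_potential n) - mon (leading_word n z)) (Word s) \<noteq> (0 :: 'a)"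
  obtain k where k: "n = Suc (Suc (Suc k))" using ge_3_Suc[OF assms] by blast
  have "leading_word n Lx = replicate (Suc k) Lx @ [Ly, Ly] @ replicate (n - 1 - (Suc (Suc k))) Lx"
    by (simp add: k leading_word.simps)
  then have "Lx # leading_word n Lx = replicate (Suc (Suc k)) Lx @ [Ly, Ly] @ replicate (n - 1 - (Suc (Suc k))) Lx"
    by simp
  moreover have "Suc (Suc k) < n" by (simp add: k)
  ultimately have "Lx # leading_word n Lx \<in> model_words n"
    unfolding model_words_def by blast
  moreover have "Ly # leading_word n Ly \<in> model_words n"
    by (simp add: model_words_def leading_word.simps)
  ultimately have leading_word: "z # leading_word n z \<in> model_words n" by (cases z) auto
  from * have s: "s \<noteq> leading_word n z" "z # s \<in> model_words n"
    using leading_word by (auto simp: lookup_minus lookup_single when_def split: if_splits)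
  show "s \<in> smaller_words (leading_word n z)"
  proof (cases z)
    case Lx
    with s obtain i where i: "i < n" "Lx # s = replicate i Lx @ [Ly, Ly] @ replicate (n - 1 - i) Lx"
      unfolding model_words_def by auto
    then obtain j where j: "i = Suc j" by (cases i) auto
    with i have s': "s = replicate j Lx @ [Ly, Ly] @ replicate (n - 2 - j) Lx" by simp
    with s i j have "j \<noteq> n - 2" using Lx by (auto simp: leading_word.simps)
    with i j have "j < n - 2" by simp
    then show ?thesis using k
      by (simp add: s' Lx smaller_words_def leading_word.simps inversions_append count_list_replicate_letter
          del: replicate_Suc)
  next
    case Ly
    have "s = replicate (n - 1) Lx @ [Ly] \<or> s = Ly # replicate (n - 1) Lx"
    proof -
      from s Ly consider "Ly # s = Ly # replicate (n - 1) Lx @ [Ly]"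
        | i where "Ly # s = replicate i Lx @ [Ly, Ly] @ replicate (n - 1 - i) Lx"
        unfolding model_words_def by blast
      then show ?thesis
      proof cases
        case 2
        then show ?thesis by (cases i) auto
      qed simp
    qed
    with s Ly have "s = Ly # replicate (n - 1) Lx" by (simp add: leading_word.simps)
    then show ?thesis using k
      by (simp add: Ly smaller_words_def leading_word.simps inversions_append count_list_replicate_letter
          del: replicate_Suc)
  qed
qed

lemma adapted_model_potential_unitriangular:
  assumes "n \<ge> 3"
  shows "adapted n (model_potential n :: 'k::field free_poly) l - mon l \<in> fa.span (mon ` smaller_words l)"
proof (induction l)
  case Nil
  then show ?case by (simp add: fa.span_zero)
next
  case (Cons a l)
  let ?G = "model_potential n :: 'k free_poly"
  have sandwich: "mon u * p * mon v \<in> fa.span (mon ` smaller_words (u @ t @ v))"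
    if "p \<in> fa.span (mon ` smaller_words t)" for u v t and p :: "'k free_poly"
    using that by (rule span_mult_closed) (auto intro!: fa.span_base imageI smaller_words_append)
  show ?case
  proof (cases "normal_word n l")
    case False
    then have "adapted n ?G (a # l) - mon (a # l) =
        mon [a] * (adapted n ?G l - mon l) * mon []"
      by (simp add: right_diff_distrib)
    then show ?thesis using sandwich[OF Cons.IH, of "[a]" "[]"] by (simp del: adapted.simps)
  next
    case True
    show ?thesis
    proof (cases "\<exists>z. take n (a # l) = leading_word n z")
      case False
      then have "normal_word n (a # l)" using True by auto
      then show ?thesis by (simp add: adapted_normal fa.span_zero del: adapted.simps)
    next
      case True': True
      then obtain z w where w: "a # l = leading_word n z @ w"
        using take_eq_leading_word_iff[of n "a # l"] assms by auto
      have "l = tl (leading_word n z) @ w"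
        using w leading_word_eq_Cons[OF assms(1), of z] by (metis append_Cons list.inject)
      with True have "adapted n ?G (a # l) - mon (a # l) =
          mon [] * (partial z ?G - mon (leading_word n z)) * mon w"
        unfolding w using adapted_leading_word[OF assms(1)] by (simp add: left_diff_distrib)
      then show ?thesis
        using sandwich[OF partial_model_potential[OF assms, of z], of "[]" w] w by (simp del: adapted.simps)
    qed
  qed
qed

text \<open>
  A unitriangular system can be solved by induction on the number of inversions.
\<close>

lemma adapted_model_potential_spans:
  assumes "n \<ge> 3"
  shows "hom_part m \<subseteq> fa.span (adapted n (model_potential n) ` words m)"
proof -
  have "mon l \<in> fa.span (adapted n (model_potential n :: 'a free_poly) ` words (length l))" for l
  proof (induction "inversions l" arbitrary: l rule: less_induct)
    case less
    let ?S = "fa.span (adapted n (model_potential n :: 'a free_poly) ` words (length l))"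
    have "mon ` smaller_words l \<subseteq> ?S"
      using less by (force simp: smaller_words_def)
    then have "fa.span (mon ` smaller_words l) \<subseteq> ?S"
      by (intro fa.span_minimal) simp_all
    then have "adapted n (model_potential n) l - mon l \<in> ?S"
      using adapted_model_potential_unitriangular[OF assms] by blast
    moreover have "adapted n (model_potential n) l \<in> ?S"
      by (intro fa.span_base) (simp add: words_def)
    ultimately have "adapted n (model_potential n) l - (adapted n (model_potential n) l - mon l) \<in> ?S"
      by (rule fa.span_diff[rotated])
    then show ?case by simp
  qed
  then have "mon ` words m \<subseteq> fa.span (adapted n (model_potential n :: 'a free_poly) ` words m)"
    by (auto simp: words_def)
  then show ?thesis
    unfolding span_words[symmetric] by (intro fa.span_minimal) simp_all
qed

text \<open>
  There are as many adapted elements of degree \<open>m\<close> as words, that is, as the dimension of the space that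
  they span.
\<close>

lemma adapted_spanning_imp_independent:
  assumes "hom_part m \<subseteq> fa.span (adapted n G ` words m)" and "n \<ge> 3" "homogeneous (Suc n) G"
  shows "fa.independent (adapted n G ` words m)" "inj_on (adapted n G) (words m)"
proof -
  have "adapted n G ` words m \<subseteq> hom_part m"
    using adapted_homogeneous[OF assms(2,3)] by (auto simp: words_def)
  then have "fa.span (adapted n G ` words m) = hom_part m"
    using assms(1) fa.span_minimal[OF _ subspace_hom_part] by blast
  then have dim: "fa.dim (fa.span (adapted n G ` words m)) = 2 ^ m"
    by (simp add: dim_hom_part)
  have le: "card (adapted n G ` words m) \<le> 2 ^ m"
    using card_image_le[of "words m" "adapted n G"] by (simp add: card_words)
  then show "fa.independent (adapted n G ` words m)"
    by (intro independent_if_card_le_dim) (simp_all add: dim del: fa.dim_span)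
  then have "card (adapted n G ` words m) = 2 ^ m"
    using dim by (simp add: fa.dim_eq_card_independent)
  then show "inj_on (adapted n G) (words m)"
    by (intro eq_card_imp_inj_on) (simp_all add: card_words)
qed

text \<open>
  Equality holds because the adapted elements of the reducible words are independent as well.
\<close>

lemma dim_ideal_part_model_potential:
  assumes "n \<ge> 3"
  shows "fa.dim (ideal_part n (model_potential n :: 'k::field free_poly) m) = card (reducible_words n m)"
proof (rule antisym)
  let ?G = "model_potential n :: 'k free_poly"
  have hom: "homogeneous (Suc n) ?G" using assms by (simp add: homogeneous_model_potential)
  show "fa.dim (ideal_part n ?G m) \<le> card (reducible_words n m)"
    using assms hom by (intro dim_ideal_part_le potential_model_potential adapted_model_potential_spans)
  note b = adapted_spanning_imp_independent[OF adapted_model_potential_spans[OF assms, of m] assms hom]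
  have "card (reducible_words n m) = card (adapted n ?G ` reducible_words n m)"
    using b(2) by (intro card_image[symmetric]) (auto intro: inj_on_subset)
  also have "fa.independent (adapted n ?G ` reducible_words n m)"
    using b(1) by (rule fa.independent_mono) auto
  then have "card (adapted n ?G ` reducible_words n m) = fa.dim (adapted n ?G ` reducible_words n m)"
    by (simp add: fa.dim_eq_card_independent)
  also have "\<dots> \<le> fa.dim (ideal_part n ?G m)"
  proof -
    have "ideal_part n ?G m \<subseteq> reducible_span n ?G m"
      using assms hom
      by (intro ideal_part_subset_reducible_span potential_model_potential adapted_model_potential_spans)
    moreover have "reducible_span n ?G m \<subseteq> ideal_part n ?G m"
      using adapted_in_ideal_part[OF assms, of _ ?G]
      by (intro fa.span_minimal) (auto simp: words_def)
    ultimately have "ideal_part n ?G m = reducible_span n ?G m" by blast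
    then show ?thesis by simp
  qed
  finally show "card (reducible_words n m) \<le> fa.dim (ideal_part n ?G m)" .
qed

section \<open>Specialisation of the indeterminate\<close>

text \<open>
  The coefficients of \<open>p'\<close> are polynomials in the indeterminate, and giving it the value \<open>c\<close> turns \<open>p'\<close>
  into \<open>p\<close>.
\<close>

definition specialises :: "'k::field \<Rightarrow> 'k poly fract free_poly \<Rightarrow> 'k free_poly \<Rightarrow> bool" where
  "specialises c p' p \<longleftrightarrow>
    (\<forall>s. \<exists>P. Poly_Mapping.lookup p' (Word s) = to_fract P \<and> poly P c = Poly_Mapping.lookup p (Word s))"

lemma specialises_mon: "specialises c (mon l) (mon l)"
  unfolding specialises_def
proof
  fix s
  show "\<exists>P. Poly_Mapping.lookup (mon l) (Word s) = to_fract P \<and> poly P c = Poly_Mapping.lookup (mon l) (Word s)"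
    by (rule exI[of _ "if s = l then 1 else 0"]) (auto simp: lookup_single when_def)
qed

lemma specialises_zero: "\<exists>P. 0 = to_fract P \<and> poly P c = 0"
  by (rule exI[of _ 0]) simp

lemma specialises_partial: "specialises c p' p \<Longrightarrow> specialises c (partial z p') (partial z p)"
  by (simp add: specialises_def)

lemma specialises_mon_mult:
  assumes "specialises c p' p"
  shows "specialises c (mon u * p') (mon u * p)"
  unfolding specialises_def
proof
  fix s
  show "\<exists>P. Poly_Mapping.lookup (mon u * p') (Word s) = to_fract P \<and>
      poly P c = Poly_Mapping.lookup (mon u * p) (Word s)"
  proof (cases "\<exists>t. s = u @ t")
    case True
    then show ?thesis using assms by (auto simp: lookup_mon_mult specialises_def)
  next
    case False
    then show ?thesis by (simp add: lookup_mon_mult_zero specialises_zero)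
  qed
qed

lemma specialises_mult_mon:
  assumes "specialises c p' p"
  shows "specialises c (p' * mon v) (p * mon v)"
  unfolding specialises_def
proof
  fix s
  show "\<exists>P. Poly_Mapping.lookup (p' * mon v) (Word s) = to_fract P \<and>
      poly P c = Poly_Mapping.lookup (p * mon v) (Word s)"
  proof (cases "\<exists>t. s = t @ v")
    case True
    then show ?thesis using assms by (auto simp: lookup_mult_mon specialises_def)
  next
    case False
    then show ?thesis by (simp add: lookup_mult_mon_zero specialises_zero)
  qed
qed

lemma specialises_adapted:
  assumes "specialises c G' G"
  shows "specialises c (adapted n G' l) (adapted n G l)"
proof (induction l)
  case Nil
  then show ?case using specialises_mon[of c "[]"] by simp
next
  case (Cons a l)
  then show ?case
    using specialises_mon[of c "a # l"]
    by (simp add: specialises_mon_mult specialises_mult_mon specialises_partial assms)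
qed

lemma family_independent_iff:
  assumes "finite I"
  shows "fa.independent (f ` I) \<and> inj_on f I \<longleftrightarrow>
    (\<forall>u. (\<Sum>i\<in>I. u i \<cdot> f i) = 0 \<longrightarrow> (\<forall>i\<in>I. u i = 0))"
proof
  assume *: "fa.independent (f ` I) \<and> inj_on f I"
  show "\<forall>u. (\<Sum>i\<in>I. u i \<cdot> f i) = 0 \<longrightarrow> (\<forall>i\<in>I. u i = 0)"
  proof (intro allI impI ballI)
    fix u i assume u: "(\<Sum>i\<in>I. u i \<cdot> f i) = 0" and i: "i \<in> I"
    have "(\<Sum>x\<in>f ` I. u (the_inv_into I f x) \<cdot> x) = (\<Sum>i\<in>I. u i \<cdot> f i)"
      using * by (subst sum.reindex) (auto simp: the_inv_into_f_f intro!: sum.cong)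
    then have "\<forall>x\<in>f ` I. u (the_inv_into I f x) = 0"
      using * u assms fa.dependent_finite[of "f ` I"] by auto
    then show "u i = 0" using * i by (auto simp: the_inv_into_f_f)
  qed
next
  assume *: "\<forall>u. (\<Sum>i\<in>I. u i \<cdot> f i) = 0 \<longrightarrow> (\<forall>i\<in>I. u i = 0)"
  have inj: "inj_on f I"
  proof (rule inj_onI, rule ccontr)
    fix i j assume ij: "i \<in> I" "j \<in> I" "f i = f j" "i \<noteq> j"
    let ?u = "\<lambda>k. if k = i then 1 else if k = j then - 1 else 0 :: 'b"
    have "(\<Sum>k\<in>I. ?u k \<cdot> f k) = (\<Sum>k\<in>{i, j}. ?u k \<cdot> f k)"
      using assms ij by (intro sum.mono_neutral_right) auto
    also have "\<dots> = 0" using ij by simp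
    finally have "?u i = 0" using spec[OF *, of ?u] ij(1) by blast
    then show False by simp
  qed
  moreover have "fa.independent (f ` I)"
  proof (rule fa.independent_if_scalars_zero)
    fix g x assume g: "(\<Sum>x\<in>f ` I. g x \<cdot> x) = 0" "x \<in> f ` I"
    then have "(\<Sum>i\<in>I. g (f i) \<cdot> f i) = 0"
      using inj by (simp add: sum.reindex)
    then have "\<forall>i\<in>I. g (f i) = 0"
      using spec[OF *, of "\<lambda>i. g (f i)"] by blast
    with g show "g x = 0" by blast
  qed (use assms in simp)
  ultimately show "fa.independent (f ` I) \<and> inj_on f I" by blast
qed

lemma to_fract_sum: "to_fract (\<Sum>i\<in>I. f i) = (\<Sum>i\<in>I. to_fract (f i))"
  by (induction I rule: infinite_finite_induct) simp_all

lemma common_denominator: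
  fixes u :: "'i \<Rightarrow> 'a::idom fract"
  assumes "finite I"
  shows "\<exists>d v. d \<noteq> 0 \<and> (\<forall>i\<in>I. to_fract d * u i = to_fract (v i))"
  using assms
proof (induction I)
  case empty
  show ?case by (rule exI[of _ 1]) simp
next
  case (insert j I)
  then obtain d v where d: "d \<noteq> 0" "\<forall>i\<in>I. to_fract d * u i = to_fract (v i)" by blast
  obtain a b where ab: "u j = Fract a b" "b \<noteq> 0" by (cases "u j") auto
  have "to_fract (d * b) * u i = to_fract (if i = j then d * a else b * v i)" if "i \<in> insert j I" for i
  proof (cases "i = j")
    case True
    have "to_fract b * u j = to_fract a"
      using ab by (simp add: Fract_conv_to_fract)
    then show ?thesis using True by (simp add: mult.assoc)
  next
    case False
    then show ?thesis using that d by (simp add: mult.commute mult.left_commute)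
  qed
  moreover have "d * b \<noteq> 0" using d ab by simp
  ultimately show ?case
    by (intro exI[of _ "d * b"] exI[of _ "\<lambda>i. if i = j then d * a else b * v i"] conjI ballI)
qed

text \<open>
  As long as all coefficients of the relation vanish at \<open>c\<close>, they can be divided by \<open>t - c\<close>; this lowers
  the degree of the nonzero coefficient \<open>v j\<close>, so it cannot go on forever.
\<close>

lemma remove_common_root:
  fixes v :: "'i \<Rightarrow> 'k::field poly" and f :: "'i \<Rightarrow> 'k poly fract free_poly"
  assumes "(\<Sum>i\<in>I. to_fract (v i) \<cdot> f i) = 0" "j \<in> I" "v j \<noteq> 0"
  shows "\<exists>w. (\<Sum>i\<in>I. to_fract (w i) \<cdot> f i) = 0 \<and> (\<exists>i\<in>I. poly (w i) c \<noteq> 0)"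
  using assms
proof (induction "degree (v j)" arbitrary: v rule: less_induct)
  case less
  show ?case
  proof (cases "\<exists>i\<in>I. poly (v i) c \<noteq> 0")
    case True
    then show ?thesis using less.prems by blast
  next
    case False
    then have "\<forall>i\<in>I. \<exists>q. v i = [:- c, 1:] * q"
      by (auto simp: poly_eq_0_iff_dvd dvd_def)
    then have "\<exists>w. \<forall>i\<in>I. v i = [:- c, 1:] * w i" by (rule bchoice)
    then obtain w where w: "\<forall>i\<in>I. v i = [:- c, 1:] * w i" by blast
    have "to_fract [:- c, 1:] \<cdot> (\<Sum>i\<in>I. to_fract (w i) \<cdot> f i) = (\<Sum>i\<in>I. to_fract (v i) \<cdot> f i)"
      unfolding fa.scale_sum_right using w by (intro sum.cong refl) (simp flip: to_fract_mult)
    then have "(\<Sum>i\<in>I. to_fract (w i) \<cdot> f i) = 0"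
      using less.prems by simp
    moreover have wj: "w j \<noteq> 0" using w less.prems by auto
    moreover have "degree (w j) < degree (v j)"
    proof -
      have "degree (v j) = degree [:- c, 1:] + degree (w j)"
        using w less.prems(2) wj degree_mult_eq[of "[:- c, 1:]" "w j"] by simp
      then show ?thesis by simp
    qed
    ultimately show ?thesis using less.hyps less.prems(2) by blast
  qed
qed

text \<open>
  A nontrivial relation over the rational functions can be cleared of denominators and of common
  factors \<open>t - c\<close>; its value at \<open>t = c\<close> is then a nontrivial relation over the ground field.
\<close>

lemma specialises_independent:
  fixes f :: "'i \<Rightarrow> 'k::field free_poly"
  assumes "finite I" and sp: "\<And>i. i \<in> I \<Longrightarrow> specialises c (f' i) (f i)"
    and indep: "fa.independent (f ` I)" "inj_on f I"
  shows "fa.independent (f' ` I) \<and> inj_on f' I"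
  unfolding family_independent_iff[OF assms(1)]
proof (intro allI impI ballI, rule ccontr)
  fix u j assume u: "(\<Sum>i\<in>I. u i \<cdot> f' i) = 0" and j: "j \<in> I" "u j \<noteq> 0"
  obtain d v where d: "d \<noteq> 0" "\<forall>i\<in>I. to_fract d * u i = to_fract (v i)"
    using common_denominator[OF assms(1)] by blast
  have "(\<Sum>i\<in>I. to_fract (v i) \<cdot> f' i) = to_fract d \<cdot> (\<Sum>i\<in>I. u i \<cdot> f' i)"
    unfolding fa.scale_sum_right using d by (intro sum.cong refl) simp
  moreover have "v j \<noteq> 0" using d j by (metis mult_eq_0_iff to_fract_eq_0_iff)
  ultimately obtain w where w: "(\<Sum>i\<in>I. to_fract (w i) \<cdot> f' i) = 0" "\<exists>i\<in>I. poly (w i) c \<noteq> 0"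
    using remove_common_root[where I = I and v = v and f = f' and j = j and c = c] u j by auto
  have "(\<Sum>i\<in>I. poly (w i) c \<cdot> f i) = 0"
  proof (rule free_poly_eqI)
    fix s
    have "\<forall>i\<in>I. \<exists>P. Poly_Mapping.lookup (f' i) (Word s) = to_fract P \<and>
        poly P c = Poly_Mapping.lookup (f i) (Word s)"
      using sp unfolding specialises_def by blast
    then have "\<exists>P. \<forall>i\<in>I. Poly_Mapping.lookup (f' i) (Word s) = to_fract (P i) \<and>
        poly (P i) c = Poly_Mapping.lookup (f i) (Word s)" by (rule bchoice)
    then obtain P where P: "\<forall>i\<in>I. Poly_Mapping.lookup (f' i) (Word s) = to_fract (P i) \<and>
        poly (P i) c = Poly_Mapping.lookup (f i) (Word s)" by blast
    have "to_fract (\<Sum>i\<in>I. w i * P i) = Poly_Mapping.lookup (\<Sum>i\<in>I. to_fract (w i) \<cdot> f' i) (Word s)"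
      using P by (simp add: to_fract_sum lookup_sum)
    then have "(\<Sum>i\<in>I. w i * P i) = 0" by (simp only: w lookup_zero to_fract_eq_0_iff)
    then have "poly (\<Sum>i\<in>I. w i * P i) c = 0" by simp
    then show "Poly_Mapping.lookup (\<Sum>i\<in>I. poly (w i) c \<cdot> f i) (Word s) = Poly_Mapping.lookup 0 (Word s)"
      using P by (simp add: poly_sum lookup_sum)
  qed
  then have "\<forall>i\<in>I. poly (w i) c = 0"
    using spec[OF iffD1[OF family_independent_iff[OF assms(1), of f] conjI[OF indep]],
      of "\<lambda>i. poly (w i) c"] by blast
  with w show False by blast
qed

text \<open>
  The polynomial \<open>(1 - t) F + t G\<close>.
\<close>

definition pencil :: "'k::field free_poly \<Rightarrow> 'k free_poly \<Rightarrow> 'k poly fract free_poly" where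
  "pencil F G = Abs_poly_mapping (\<lambda>s. to_fract
     [:Poly_Mapping.lookup F s, Poly_Mapping.lookup G s - Poly_Mapping.lookup F s:])"

lemma lookup_pencil [simp]:
  "Poly_Mapping.lookup (pencil F G) s =
    to_fract [:Poly_Mapping.lookup F s, Poly_Mapping.lookup G s - Poly_Mapping.lookup F s:]"
proof -
  have "{s. to_fract [:Poly_Mapping.lookup F s, Poly_Mapping.lookup G s - Poly_Mapping.lookup F s:] \<noteq> 0}
      \<subseteq> Poly_Mapping.keys F \<union> Poly_Mapping.keys G"
    by (auto simp: in_keys_iff)
  then have "finite {s. to_fract
      [:Poly_Mapping.lookup F s, Poly_Mapping.lookup G s - Poly_Mapping.lookup F s:] \<noteq> 0}"
    by (rule finite_subset) simp
  then show ?thesis by (simp add: pencil_def)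
qed

lemma specialises_pencil:
  "specialises 0 (pencil F G) F" "specialises 1 (pencil F G) G"
  unfolding specialises_def lookup_pencil to_fract_eq_iff by auto

lemma potential_pencil: "potential F \<Longrightarrow> potential G \<Longrightarrow> potential (pencil F G)"
  by (simp add: potential_iff)

lemma homogeneous_pencil: "homogeneous m F \<Longrightarrow> homogeneous m G \<Longrightarrow> homogeneous m (pencil F G)"
  by (simp add: homogeneous_alt)

text \<open>
  The adapted elements of the model potential are independent. They are the values at \<open>t = 0\<close>, so those
  of the pencil are independent too, and there are enough of them to span.
\<close>

lemma adapted_pencil_spans:
  fixes F :: "'k::field free_poly"
  assumes "n \<ge> 3" "homogeneous (Suc n) F"
  shows "hom_part m \<subseteq> fa.span (adapted n (pencil (model_potential n) F) ` words m)"
proof -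
  let ?M = "model_potential n :: 'k free_poly" and ?P = "pencil (model_potential n) F"
  have hom: "homogeneous (Suc n) ?M" using assms by (simp add: homogeneous_model_potential)
  note b = adapted_spanning_imp_independent[OF adapted_model_potential_spans[OF assms(1)] assms(1) hom, of m]
  have "fa.independent (adapted n ?P ` words m) \<and> inj_on (adapted n ?P) (words m)"
    by (rule specialises_independent[OF finite_words _ b])
      (rule specialises_adapted[OF specialises_pencil(1)])
  moreover have "adapted n ?P ` words m \<subseteq> hom_part m"
    using adapted_homogeneous[OF assms(1) homogeneous_pencil[OF hom assms(2)]]
    by (auto simp: words_def)
  ultimately show ?thesis
    by (intro span_if_dim_le_card) (simp_all add: dim_hom_part card_image card_words)
qed

text \<open>
  A basis of the ideal part of \<open>F\<close> consisting of multiples \<open>u r v\<close> is the value at \<open>t = 1\<close> of the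
  corresponding multiples for the pencil. Those are therefore independent, and the pencil satisfies
  the spanning hypothesis of \<open>ideal_part_subset_reducible_span\<close>.
\<close>

lemma dim_ideal_part_le_card_reducible_words:
  fixes F :: "'k::field free_poly"
  assumes "n \<ge> 3" "potential F" "homogeneous (Suc n) F"
  shows "fa.dim (ideal_part n F m) \<le> card (reducible_words n m)"
proof -
  let ?P = "pencil (model_potential n) F"
  have hom: "homogeneous (Suc n) ?P"
    using assms by (simp add: homogeneous_pencil homogeneous_model_potential)
  have pot: "potential ?P"
    using assms by (simp add: potential_pencil potential_model_potential)
  obtain B where B: "B \<subseteq> multiples n F m" "fa.independent B" "multiples n F m \<subseteq> fa.span B"
    by (rule fa.maximal_independent_subset)
  have "ideal_part n F m = fa.span B"
  proof (rule subset_antisym)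
    show "ideal_part n F m \<subseteq> fa.span B"
      by (rule fa.span_minimal[OF B(3) fa.subspace_span])
    show "fa.span B \<subseteq> ideal_part n F m"
      by (rule fa.span_mono[OF B(1)])
  qed
  then have dim: "fa.dim (ideal_part n F m) = card B"
    using B(2) by (simp add: fa.dim_eq_card_independent)
  have "B \<subseteq> fa.span (mon ` words m)"
    using B(1) ideal_part_subset_hom_part[OF assms(3), of m] fa.span_superset[of "multiples n F m"]
    unfolding span_words by blast
  then have fin: "finite B"
    using fa.independent_span_bound[OF _ B(2), of "mon ` words m"] by simp
  have "\<forall>b\<in>B. \<exists>b'. specialises 1 b' b \<and> b' \<in> multiples n ?P m"
  proof
    fix b assume "b \<in> B"
    then obtain u z v where b: "b = mon u * partial z F * mon v" "length u + n + length v = m"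
      using B(1) unfolding multiples_def by blast
    have "specialises 1 (mon u * partial z ?P * mon v) b"
      unfolding b(1) by (intro specialises_mult_mon specialises_mon_mult specialises_partial specialises_pencil)
    with multiplesI[OF b(2), of z ?P]
    show "\<exists>b'. specialises 1 b' b \<and> b' \<in> multiples n ?P m" by blast
  qed
  then have "\<exists>g. \<forall>b\<in>B. specialises 1 (g b) b \<and> g b \<in> multiples n ?P m"
    by (rule bchoice)
  then obtain g where g: "\<And>b. b \<in> B \<Longrightarrow> specialises 1 (g b) b \<and> g b \<in> multiples n ?P m"
    by blast
  have ind: "fa.independent (g ` B) \<and> inj_on g B"
    using specialises_independent[OF fin, of 1 g "\<lambda>b. b"] g B(2) by simp
  have "g ` B \<subseteq> reducible_span n ?P m"
    using g ideal_part_subset_reducible_span[OF assms(1) pot hom adapted_pencil_spans[OF assms(1,3)]]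
      fa.span_superset[of "multiples n ?P m"] by blast
  then have "card (g ` B) \<le> card (adapted n ?P ` reducible_words n m)"
    using fa.independent_span_bound[of "adapted n ?P ` reducible_words n m" "g ` B"] ind by simp
  also have "\<dots> \<le> card (reducible_words n m)" by (intro card_image_le) simp
  finally show ?thesis using ind by (simp add: dim card_image del: fa.dim_span)
qed

section \<open>Dimensions in the potential algebra\<close>

lemma subfield_range_scalar: "subfield (range scalar) (free_alg :: 'k::field free_poly ring)"
proof -
  interpret F: ring "free_alg :: 'k free_poly ring" by (rule ring_free_alg)
  have uminus: "\<ominus>\<^bsub>free_alg\<^esub> p = - p" for p :: "'k free_poly"
    by (rule F.minus_equality) simp_all
  have subring: "subring (range scalar) (free_alg :: 'k free_poly ring)"
  proof (rule F.subringI)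
    show "\<one>\<^bsub>free_alg\<^esub> \<in> range (scalar :: 'k \<Rightarrow> _)"
      by (rule range_eqI[of _ _ 1]) simp
    show "\<ominus>\<^bsub>free_alg\<^esub> h \<in> range scalar" if "h \<in> range scalar" for h :: "'k free_poly"
    proof -
      from that obtain c where "h = scalar c" by blast
      then have "- h = scalar (- c)" by (simp add: scalar_def single_uminus)
      then show ?thesis by (simp add: uminus)
    qed
    show "h1 \<otimes>\<^bsub>free_alg\<^esub> h2 \<in> range scalar" "h1 \<oplus>\<^bsub>free_alg\<^esub> h2 \<in> range scalar"
      if h: "h1 \<in> range scalar" "h2 \<in> range scalar" for h1 h2 :: "'k free_poly"
    proof -
      from h obtain c d where "h1 = scalar c" "h2 = scalar d" by blast
      then show "h1 \<otimes>\<^bsub>free_alg\<^esub> h2 \<in> range scalar" "h1 \<oplus>\<^bsub>free_alg\<^esub> h2 \<in> range scalar"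
        by (simp_all flip: scalar_add scalar_mult)
    qed
  qed simp
  have inj: "scalar c = scalar d \<longleftrightarrow> c = d" for c d :: 'k
    by (metis lookup_single_eq scalar_def)
  show ?thesis
  proof (rule F.subfieldI)
    show "subcring (range scalar) (free_alg :: 'k free_poly ring)"
      by (rule F.subcringI[OF subring]) (auto simp flip: scalar_mult simp: mult.commute)
    have "(\<exists>d. scalar d * scalar c = (1 :: 'k free_poly) \<and> scalar c * scalar d = 1) \<longleftrightarrow> c \<noteq> 0" for c
    proof
      assume "\<exists>d. scalar d * scalar c = (1 :: 'k free_poly) \<and> scalar c * scalar d = 1"
      then show "c \<noteq> 0" by auto
    next
      assume "c \<noteq> 0"
      then have "scalar (inverse c) * scalar c = (1 :: 'k free_poly)" "scalar c * scalar (inverse c) = 1"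
        by (simp_all flip: scalar_mult)
      then show "\<exists>d. scalar d * scalar c = (1 :: 'k free_poly) \<and> scalar c * scalar d = 1" by blast
    qed
    moreover have "scalar c = (0 :: 'k free_poly) \<longleftrightarrow> c = 0" for c
      using inj[of c 0] by simp
    ultimately show "Units (free_alg\<lparr>carrier := range scalar\<rparr>) =
        range (scalar :: 'k \<Rightarrow> _) - {\<zero>\<^bsub>free_alg\<^esub>}"
      by (auto simp: Units_def)
  qed
qed

lemma ring_potential_algebra: "ring (potential_algebra F)"
  unfolding potential_algebra_def by (rule ideal.quotient_is_ring[OF ideal_potential_ideal])

lemma residue_class_hom: "residue_class F \<in> ring_hom free_alg (potential_algebra F)"
  unfolding potential_algebra_def
  using ideal.rcos_ring_hom[OF ideal_potential_ideal, of F]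
  by (simp add: residue_class_def [abs_def])

lemma residue_class_hom_ring: "ring_hom_ring free_alg (potential_algebra F) (residue_class F)"
  by (intro ring_hom_ringI2 ring_free_alg ring_potential_algebra residue_class_hom)

lemma residue_class_simps [simp]:
  "residue_class F p \<in> carrier (potential_algebra F)"
  "residue_class F (p + q) = residue_class F p \<oplus>\<^bsub>potential_algebra F\<^esub> residue_class F q"
  "residue_class F (p * q) = residue_class F p \<otimes>\<^bsub>potential_algebra F\<^esub> residue_class F q"
  "\<one>\<^bsub>potential_algebra F\<^esub> = residue_class F 1"
  using ring_hom_memE[OF residue_class_hom[of F]] by simp_all

lemma residue_class_zero: "\<zero>\<^bsub>potential_algebra F\<^esub> = residue_class F 0"
  using ring_hom_zero[OF residue_class_hom[of F] ring_free_alg ring_potential_algebra] by simp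

lemma residue_class_eq_iff: "residue_class F p = residue_class F q \<longleftrightarrow> p - q \<in> potential_ideal F"
proof -
  interpret R: ring "free_alg :: 'a free_poly ring" by (rule ring_free_alg)
  have "\<ominus>\<^bsub>free_alg\<^esub> q = - q"
    by (rule R.minus_equality) simp_all
  then have "p \<ominus>\<^bsub>free_alg\<^esub> q = p - q"
    by (simp add: a_minus_def)
  then show ?thesis
    using R.quotient_eq_iff_same_a_r_cos[OF ideal_potential_ideal, of p q F]
    by (simp add: residue_class_def)
qed

lemma subspace_potential_ideal: "fa.subspace (potential_ideal F)"
  by (simp add: potential_ideal_eq_span)

text \<open>
  The ideal is generated in positive degree, so it does not contain \<open>1\<close> and the field embeds.
\<close>

lemma subfield_ground_field:
  assumes "homogeneous (Suc n) F" "n \<ge> 1"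
  shows "subfield (ground_field F) (potential_algebra F)"
proof -
  have "(1 :: 'a free_poly) \<notin> potential_ideal F"
  proof
    assume "1 \<in> potential_ideal F"
    moreover have "(1 :: 'a free_poly) \<in> hom_part 0"
      using homogeneous_mon[of 0 "[]"] by simp
    ultimately have "(1 :: 'a free_poly) \<in> ideal_part n F 0"
      using ideal_part_eq[OF assms(1)] by blast
    moreover have "multiples n F 0 = {}" using assms by (auto simp: multiples_def)
    ultimately show False by simp
  qed
  then have "\<one>\<^bsub>potential_algebra F\<^esub> \<noteq> \<zero>\<^bsub>potential_algebra F\<^esub>"
    by (simp add: residue_class_zero residue_class_eq_iff)
  then have "subfield (residue_class F ` range scalar) (potential_algebra F)"
    by (rule ring_hom_ring.img_is_subfield(2)[OF residue_class_hom_ring subfield_range_scalar])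
  then show ?thesis by (simp add: ground_field_def image_image)
qed

lemma Span_residue_classes:
  "ring.Span (potential_algebra F) (ground_field F) (map (residue_class F) us) =
    residue_class F ` fa.span (set us)"
proof (induction us)
  case Nil
  then show ?case by (simp add: ring.Span.simps[OF ring_potential_algebra] residue_class_zero)
next
  case (Cons u us)
  let ?r = "residue_class F"
  have "ring.Span (potential_algebra F) (ground_field F) (map ?r (u # us)) =
    ring.line_extension (potential_algebra F) (ground_field F) (?r u) (?r ` fa.span (set us))"
    using Cons by (simp add: ring.Span.simps[OF ring_potential_algebra])
  also have "\<dots> = ?r ` fa.span (set (u # us))"
  proof (intro subset_antisym subsetI)
    fix x assume "x \<in> ring.line_extension (potential_algebra F) (ground_field F) (?r u) (?r ` fa.span (set us))"
    then obtain c q where q: "q \<in> fa.span (set us)" and x: "x = ?r (scalar c * u + q)"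
      unfolding ring.line_extension_mem_iff[OF ring_potential_algebra] ground_field_def by auto
    have "scalar c * u + q \<in> fa.span (set (u # us))"
      unfolding fscale_def[symmetric] using q
      by (auto intro!: fa.span_add fa.span_scale intro: fa.span_base fa.span_mono[THEN subsetD, of "set us"])
    then show "x \<in> ?r ` fa.span (set (u # us))" unfolding x by (rule imageI)
  next
    fix x assume "x \<in> ?r ` fa.span (set (u # us))"
    then obtain p c where p: "x = ?r p" "p - c \<cdot> u \<in> fa.span (set us)"
      by (auto simp: fa.span_insert)
    have "p = scalar c * u + (p - c \<cdot> u)" by (simp add: fscale_def)
    then have "x = ?r (scalar c) \<otimes>\<^bsub>potential_algebra F\<^esub> ?r u \<oplus>\<^bsub>potential_algebra F\<^esub> ?r (p - c \<cdot> u)"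
      using p(1) by (metis residue_class_simps(2,3))
    then show "x \<in> ring.line_extension (potential_algebra F) (ground_field F) (?r u) (?r ` fa.span (set us))"
      using p(2) unfolding ring.line_extension_mem_iff[OF ring_potential_algebra] ground_field_def by blast
  qed
  finally show ?case .
qed

text \<open>
  Here \<open>C\<close> stands for a basis of the ideal within \<open>V\<close>, and \<open>us\<close> lists vectors that enlarge it to an
  independent set. The subspace \<open>V\<close> will be a homogeneous component or the whole free algebra.
\<close>

lemma independent_residue_classes:
  assumes "fa.subspace V" "potential_ideal F \<inter> V \<subseteq> fa.span C"
    and "set us \<subseteq> V" "set us \<inter> C = {}" "distinct us" "fa.independent (set us \<union> C)"
  shows "ring.independent (potential_algebra F) (ground_field F) (map (residue_class F) us)"
  using assms(3-6)
proof (induction us)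
  case Nil
  then show ?case by (simp add: ring.li_Nil[OF ring_potential_algebra])
next
  case (Cons u us)
  have "residue_class F u \<notin> residue_class F ` fa.span (set us)"
  proof
    assume "residue_class F u \<in> residue_class F ` fa.span (set us)"
    then obtain q where q: "q \<in> fa.span (set us)" "u - q \<in> potential_ideal F"
      by (auto simp: residue_class_eq_iff)
    have "fa.span (set us) \<subseteq> V"
      using Cons.prems assms(1) by (intro fa.span_minimal) auto
    then have "u - q \<in> V"
      using q Cons.prems assms(1) by (intro fa.subspace_diff) auto
    with q have "u - q \<in> fa.span C" using assms(2) by blast
    then have "(u - q) + q \<in> fa.span (set us \<union> C)"
      using q(1) by (intro fa.span_add) (auto intro: fa.span_mono[THEN subsetD])
    moreover have "set us \<union> C \<subseteq> set (u # us) \<union> C - {u}"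
      using Cons.prems by auto
    then have "fa.span (set us \<union> C) \<subseteq> fa.span (set (u # us) \<union> C - {u})"
      by (rule fa.span_mono)
    ultimately have "u \<in> fa.span (set (u # us) \<union> C - {u})"
      by auto
    then show False
      using Cons.prems(4) unfolding fa.dependent_def by auto
  qed
  moreover have "fa.independent (set us \<union> C)"
    using Cons.prems(4) by (rule fa.independent_mono) auto
  ultimately show ?case
    using Cons by (simp add: ring.li_Cons[OF ring_potential_algebra] Span_residue_classes
        del: ring.Span.simps)
qed

text \<open>
  A basis of the ideal part is extended to a basis of all polynomials of degree \<open>m\<close>; the residue classes
  of the added vectors form a basis of the graded component.
\<close>

lemma dim_graded_component:
  assumes "homogeneous (Suc n) F" "n \<ge> 1"
  shows "ring.dim (potential_algebra F) (ground_field F) (graded_component F m) =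
    2 ^ m - fa.dim (ideal_part n F m)"
proof -
  let ?I = "ideal_part n F m"
  have I: "?I = potential_ideal F \<inter> hom_part m" by (rule ideal_part_eq[OF assms(1)])
  obtain C where C: "C \<subseteq> ?I" "fa.independent C" "?I \<subseteq> fa.span C" "card C = fa.dim ?I"
    by (rule fa.basis_exists)
  have "C \<subseteq> hom_part m" using C(1) I by blast
  then obtain D where D: "C \<subseteq> D" "D \<subseteq> hom_part m" "fa.independent D" "hom_part m \<subseteq> fa.span D"
    using C(2) by (rule fa.maximal_independent_subset_extend)
  have cardD: "card D = 2 ^ m"
    using fa.basis_card_eq_dim[OF D(2,4,3)] by (simp add: dim_hom_part)
  then have fin: "finite D" by (intro card_ge_0_finite) simp
  then obtain us where us: "set us = D - C" "distinct us"
    using finite_distinct_list[of "D - C"] by blast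
  have len: "length us = 2 ^ m - fa.dim ?I"
    using us fin D(1) cardD C(4)
    by (metis card_Diff_subset distinct_card finite_subset)
  have un: "set us \<union> C = D" using us D(1) by auto
  have "ring.independent (potential_algebra F) (ground_field F) (map (residue_class F) us)"
    by (rule independent_residue_classes[OF subspace_hom_part[of m], of F C])
       (use C D us un I in auto)
  then have "ring.dimension (potential_algebra F) (length (map (residue_class F) us)) (ground_field F)
      (ring.Span (potential_algebra F) (ground_field F) (map (residue_class F) us))"
    by (rule ring.dimension_independent[OF ring_potential_algebra])
  moreover have "residue_class F ` fa.span (set us) = graded_component F m"
    unfolding graded_component_def
  proof (intro subset_antisym image_subsetI)
    fix p assume "p \<in> fa.span (set us)"
    moreover have "fa.span (set us) \<subseteq> hom_part m"
      using us D(2) by (intro fa.span_minimal subspace_hom_part) auto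
    ultimately show "residue_class F p \<in> residue_class F ` hom_part m" by blast
  next
    fix p :: "'a free_poly" assume "p \<in> hom_part m"
    then have "p \<in> fa.span (set us \<union> C)" using D(4) un by auto
    then obtain x y where xy: "p = x + y" "x \<in> fa.span (set us)" "y \<in> fa.span C"
      by (auto simp: fa.span_Un)
    have "fa.span C \<subseteq> potential_ideal F"
      using C(1) I by (intro fa.span_minimal subspace_potential_ideal) auto
    with xy have "residue_class F p = residue_class F x"
      by (subst residue_class_eq_iff) auto
    with xy show "residue_class F p \<in> residue_class F ` fa.span (set us)" by blast
  qed
  ultimately have "ring.dimension (potential_algebra F) (2 ^ m - fa.dim ?I) (ground_field F)
      (graded_component F m)"
    by (simp add: Span_residue_classes len del: ring.Span.simps)
  then show ?thesis
    using ring.dimI[OF ring_potential_algebra subfield_ground_field[OF assms]]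
    by (simp add: over_def)
qed

text \<open>
  Nonzero residue classes of homogeneous polynomials of distinct degrees are independent, because the
  ideal is homogeneous.
\<close>

lemma infinite_dimensional_if_components_nonzero:
  assumes "homogeneous (Suc n) F" "n \<ge> 1" "\<And>m. fa.dim (ideal_part n F m) < 2 ^ m"
  shows "infinite_dimensional F"
proof -
  have "\<exists>p. p \<in> hom_part m \<and> p \<notin> potential_ideal F" for m
  proof (rule ccontr)
    assume "\<nexists>p. p \<in> hom_part m \<and> p \<notin> potential_ideal F"
    then have "ideal_part n F m = hom_part m"
      using ideal_part_eq[OF assms(1), of m] by blast
    then have "fa.dim (ideal_part n F m) = 2 ^ m" by (simp only: dim_hom_part)
    with assms(3)[of m] show False by simp
  qed
  then obtain p where p: "\<And>m. homogeneous m (p m)" "\<And>m. p m \<notin> potential_ideal F"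
    by (metis mem_Collect_eq)
  obtain C where C: "C \<subseteq> potential_ideal F" "fa.independent C" "potential_ideal F \<subseteq> fa.span C"
    by (rule fa.maximal_independent_subset)
  have span_C: "fa.span C = potential_ideal F"
    using C fa.span_minimal[OF C(1) subspace_potential_ideal] by blast
  \<comment> \<open>taking the component of degree \<open>k\<close> kills the polynomials of smaller degree\<close>
  have new: "p k \<notin> fa.span (p ` {..<k} \<union> C)" for k
  proof
    assume "p k \<in> fa.span (p ` {..<k} \<union> C)"
    then obtain x y where xy: "p k = x + y" "x \<in> fa.span (p ` {..<k})" "y \<in> potential_ideal F"
      by (auto simp: fa.span_Un span_C)
    have "component k x = 0"
      using xy(2)
    proof (induction rule: fa.span_induct_alt)
      case (step c q r)
      then obtain j where "j < k" "q = p j" by blast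
      with step p(1)[of j] show ?case
        by (simp add: component_add component_fscale component_homogeneous[of j])
    qed simp
    then have "p k = component k y"
      using p(1)[of k] component_homogeneous[of k "p k" k] by (simp add: xy(1) component_add)
    then have "p k \<in> ideal_part n F k"
      using component_potential_ideal[OF assms(1) xy(3)] by simp
    then show False using ideal_part_eq[OF assms(1)] p(2) by blast
  qed
  have ind: "fa.independent (p ` {..<k} \<union> C) \<and> inj_on p {..<k}" for k
  proof (induction k)
    case (Suc k)
    have "p ` {..<Suc k} \<union> C = insert (p k) (p ` {..<k} \<union> C)"
      by (simp add: lessThan_Suc)
    moreover have "p k \<notin> p ` {..<k}"
      using new[of k] by (metis Un_iff fa.span_base)
    ultimately show ?case
      using Suc new[of k] by (simp add: fa.independent_insertI lessThan_Suc)
  qed (use C in simp)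
  have "\<not> ring.dimension (potential_algebra F) k (ground_field F) (carrier (potential_algebra F))" for k
  proof
    assume k: "ring.dimension (potential_algebra F) k (ground_field F) (carrier (potential_algebra F))"
    have us: "set (map p [0..<Suc k]) = p ` {..<Suc k}"
      by (simp only: set_map set_upt atLeast0LessThan)
    have "ring.independent (potential_algebra F) (ground_field F)
        (map (residue_class F) (map p [0..<Suc k]))"
    proof (rule independent_residue_classes[OF fa.subspace_UNIV, of F C])
      show "set (map p [0..<Suc k]) \<inter> C = {}"
        unfolding us using p(2) C(1) by blast
      show "distinct (map p [0..<Suc k])"
        unfolding distinct_map set_upt atLeast0LessThan using ind[of "Suc k"] by simp
      show "fa.independent (set (map p [0..<Suc k]) \<union> C)"
        unfolding us using ind[of "Suc k"] by simp
    qed (use C in auto)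
    then have "length (map (residue_class F) (map p [0..<Suc k])) \<le> k"
      by (rule ring.independent_length_le_dimension[OF ring_potential_algebra
            subfield_ground_field[OF assms(1,2)] k]) auto
    then show False by simp
  qed
  then show ?thesis
    unfolding infinite_dimensional_def ring.finite_dimension_def[OF ring_potential_algebra] by blast
qed

section \<open>Counting normal words\<close>

lemma card_normal_words_0 [simp]: "card (normal_words n 0) = 1"
proof -
  have "normal_words n 0 = {[]}" by (auto simp: words_def)
  then show ?thesis by simp
qed

lemma card_normal_words_Ly:
  assumes "n \<ge> 3"
  shows "card {w \<in> normal_words n (Suc k). \<exists>w'. w = Ly # w'} = card (normal_words n k)"
proof -
  have "{w \<in> normal_words n (Suc k). \<exists>w'. w = Ly # w'} = (#) Ly ` normal_words n k"
    using normal_Ly[OF assms] by (auto simp: words_def simp del: normal_word.simps)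
  then show ?thesis by (simp add: card_image)
qed

text \<open>
  Putting a letter in front of a normal word of length \<open>m\<close> gives \<open>2 N\<^sub>m\<close> words, where \<open>N\<^sub>m\<close> is the
  number of normal words of length \<open>m\<close>. The ones that are not normal begin with a leading word. For
  \<open>x^(n-2) y y\<close> it is followed by any normal word, and for \<open>x^(n-1) y\<close> by a normal word that does not
  begin with \<open>y\<close>. There are \<open>N\<^sub>m\<^sub>+\<^sub>1\<^sub>-\<^sub>n - N\<^sub>m\<^sub>-\<^sub>n\<close> of the latter, because the normal words beginning
  with \<open>y\<close> are the words \<open>y w\<close> with \<open>w\<close> normal. Terms with a negative index are zero.
\<close>

lemma card_normal_words_recurrence:
  assumes "n \<ge> 3"
  shows "card (normal_words n (Suc m)) +
      (if n \<le> Suc m then 2 * card (normal_words n (Suc m - n)) else 0) =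
    2 * card (normal_words n m) + (if n \<le> m then card (normal_words n (m - n)) else 0)"
proof -
  define T where "T = {l \<in> words (Suc m). normal_word n (tl l)}"
  define A where "A z = {w. normal_word n (tl (leading_word n z) @ w) \<and> n + length w = Suc m}" for z
  have finA: "finite (A z)" for z
  proof (rule finite_subset[OF _ finite_words])
    show "A z \<subseteq> words (Suc m - n)" by (auto simp: A_def words_def)
  qed
  have T: "T = (\<lambda>(a, l). a # l) ` (UNIV \<times> normal_words n m)"
  proof (intro subset_antisym subsetI)
    fix l assume "l \<in> T"
    then show "l \<in> (\<lambda>(a, l). a # l) ` (UNIV \<times> normal_words n m)"
      by (cases l) (auto simp: T_def words_def)
  qed (auto simp: T_def words_def)
  have "card T = card ((UNIV :: letter set) \<times> normal_words n m)"
    unfolding T by (intro card_image inj_onI) auto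
  then have cardT: "card T = 2 * card (normal_words n m)"
    by (simp add: card_cartesian_product UNIV_letter)
  \<comment> \<open>words with a normal tail, sorted by the leading word that they begin with, if any\<close>
  have "T = normal_words n (Suc m) \<union> ((@) (leading_word n Lx) ` A Lx \<union> (@) (leading_word n Ly) ` A Ly)"
    (is "_ = _ \<union> ?B")
  proof (intro subset_antisym subsetI)
    fix l assume l: "l \<in> T"
    show "l \<in> normal_words n (Suc m) \<union> ?B"
    proof (cases "normal_word n l")
      case True
      with l show ?thesis by (simp add: T_def)
    next
      case False
      from l obtain a l' where l': "l = a # l'" by (cases l) (auto simp: T_def words_def)
      with False l obtain z where "take n l = leading_word n z" by (auto simp: T_def)
      then obtain w where w: "l = leading_word n z @ w"
        using take_eq_leading_word_iff[of n l z] assms by auto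
      moreover have "leading_word n z \<noteq> []" using leading_word_eq_Cons[OF assms, of z] by auto
      ultimately have "w \<in> A z" using l length_leading_word[of n z] assms
        by (simp add: A_def T_def words_def)
      with w show ?thesis by (cases z) auto
    qed
  next
    fix l assume "l \<in> normal_words n (Suc m) \<union> ?B"
    then consider "l \<in> normal_words n (Suc m)" | z w where "l = leading_word n z @ w" "w \<in> A z" by blast
    then show "l \<in> T"
    proof cases
      case 1
      then show ?thesis by (cases l) (auto simp: T_def words_def)
    next
      case 2
      moreover have "leading_word n z \<noteq> []" using leading_word_eq_Cons[OF assms, of z] by auto
      ultimately show ?thesis using length_leading_word[of n z] assms by (simp add: T_def A_def words_def)
    qed
  qed
  moreover have "normal_words n (Suc m) \<inter> ?B = {}"
    using reducible_leading_word_append[OF assms] by auto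
  moreover have "(@) (leading_word n Lx) ` A Lx \<inter> (@) (leading_word n Ly) ` A Ly = {}"
    using length_leading_word[of n] leading_word_inj[of n Lx Ly] assms by auto
  ultimately have "card T = card (normal_words n (Suc m)) +
      (card ((@) (leading_word n Lx) ` A Lx) + card ((@) (leading_word n Ly) ` A Ly))"
    using finA by (simp add: card_Un_disjoint)
  then have "card T = card (normal_words n (Suc m)) + (card (A Lx) + card (A Ly))"
    by (simp add: card_image inj_on_def)
  moreover have "card (A Lx) = (if n \<le> Suc m then card (normal_words n (Suc m - n)) else 0)"
  proof (cases "n \<le> Suc m")
    case True
    then have "A Lx = normal_words n (Suc m - n)"
      by (auto simp: A_def words_def normal_tl_leading_word_Lx[OF assms])
    with True show ?thesis by simp
  next
    case False
    then have "A Lx = {}" by (auto simp: A_def)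
    with False show ?thesis by simp
  qed
  moreover have "card (A Ly) + (if n \<le> m then card (normal_words n (m - n)) else 0) =
      (if n \<le> Suc m then card (normal_words n (Suc m - n)) else 0)"
  proof (cases "n \<le> Suc m")
    case True
    let ?N = "normal_words n (Suc m - n)"
    have A: "A Ly = ?N - {w \<in> ?N. \<exists>w'. w = Ly # w'}"
      using True by (auto simp: A_def words_def normal_tl_leading_word_Ly[OF assms])
    show ?thesis
    proof (cases "n \<le> m")
      case True
      then have "card {w \<in> ?N. \<exists>w'. w = Ly # w'} = card (normal_words n (m - n))"
        using card_normal_words_Ly[OF assms, of "m - n"] by (simp add: Suc_diff_le)
      moreover have "card {w \<in> ?N. \<exists>w'. w = Ly # w'} \<le> card ?N"
        by (intro card_mono) auto
      moreover have "card (?N - {w \<in> ?N. \<exists>w'. w = Ly # w'}) = card ?N - card {w \<in> ?N. \<exists>w'. w = Ly # w'}"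
        by (rule card_Diff_subset) auto
      ultimately show ?thesis unfolding A using True by presburger
    next
      case False
      with True have "n = Suc m" by simp
      moreover from this have "A Ly = ?N" unfolding A by (auto simp: words_def)
      ultimately show ?thesis by simp
    qed
  next
    case False
    then have "A Ly = {}" by (auto simp: A_def)
    with False show ?thesis by simp
  qed
  ultimately show ?thesis using cardT by simp
qed

lemma minimal_series_eq:
  assumes "n \<ge> 3"
  shows "minimal_series n = Abs_fps (\<lambda>m. of_nat (card (normal_words n m)))"
proof -
  let ?f = "Abs_fps (\<lambda>m. of_nat (card (normal_words n m))) :: rat fps"
  let ?d = "1 - 2 * fps_X + 2 * fps_X ^ n - fps_X ^ (n + 1) :: rat fps"
  have "fps_nth (?d * ?f) m = fps_nth 1 m" for m
  proof -
    have "?d * ?f = ?f - fps_const 2 * (fps_X * ?f) + fps_const 2 * (fps_X ^ n * ?f) - fps_X ^ (n + 1) * ?f"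
      by (simp add: algebra_simps fps_numeral_fps_const)
    then have d: "fps_nth (?d * ?f) m = fps_nth ?f m - 2 * fps_nth (fps_X * ?f) m
        + 2 * fps_nth (fps_X ^ n * ?f) m - fps_nth (fps_X ^ (n + 1) * ?f) m"
      by simp
    show ?thesis
    proof (cases m)
      case 0
      then show ?thesis unfolding d fps_X_power_mult_nth using assms by simp
    next
      case (Suc k)
      have "(of_nat (card (normal_words n (Suc k)) +
          (if n \<le> Suc k then 2 * card (normal_words n (Suc k - n)) else 0)) :: rat) =
        of_nat (2 * card (normal_words n k) + (if n \<le> k then card (normal_words n (k - n)) else 0))"
        by (simp only: card_normal_words_recurrence[OF assms])
      then show ?thesis unfolding Suc d[unfolded Suc fps_X_power_mult_nth]
        by (auto simp: not_le split: if_splits)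
    qed
  qed
  then have eq: "?d * ?f = 1" by (intro fps_ext) simp
  have "fps_nth ?d 0 \<noteq> 0" using assms by simp
  then show ?thesis
    using fps_inverse_unique[OF eq] by (simp add: minimal_series_def fps_divide_unit)
qed

section \<open>The minimal Hilbert series\<close>

lemma card_normal_words_pos:
  assumes "n \<ge> 3"
  shows "card (normal_words n m) > 0"
proof -
  have "normal_word n (replicate m Ly)"
    using normal_Ly[OF assms] by (induction m) (simp_all del: normal_word.simps(2))
  then have "replicate m Ly \<in> normal_words n m" by (simp add: words_def)
  then show ?thesis by (subst card_gt_0_iff) auto
qed

lemma hilbert_series_nth:
  assumes "n \<ge> 1" "homogeneous (Suc n) F"
  shows "fps_nth (hilbert_series F) m = of_nat (2 ^ m - fa.dim (ideal_part n F m))"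
  by (simp only: hilbert_series_def fps_nth_Abs_fps dim_graded_component[OF assms(2,1)])

theorem theorem1p2:
  shows "(\<forall>n\<ge>4. \<forall>F\<in>(homogeneous_potentials n :: 'k::field free_poly set).
            infinite_dimensional F) \<and>
         (\<forall>n\<ge>3.
            (\<forall>F\<in>(homogeneous_potentials (n + 1) :: 'k free_poly set).
               coeffwise_le (minimal_series n) (hilbert_series F)) \<and>
            (\<exists>F\<in>(homogeneous_potentials (n + 1) :: 'k free_poly set).
               hilbert_series F = minimal_series n))"
proof (intro conjI allI impI ballI)
  fix n :: nat and F :: "'k free_poly"
  assume "n \<ge> 4" and F: "F \<in> homogeneous_potentials n"
  then obtain k where k: "n = Suc k" "k \<ge> 3" by (cases n) auto
  show "infinite_dimensional F"
  proof (rule infinite_dimensional_if_components_nonzero)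
    show "homogeneous (Suc k) F" using F k by (simp add: homogeneous_potentials_def)
    fix m
    have "fa.dim (ideal_part k F m) \<le> 2 ^ m - card (normal_words k m)"
      using dim_ideal_part_le_card_reducible_words[of k F m] F k
      unfolding card_reducible_words by (simp add: homogeneous_potentials_def)
    also have "\<dots> < 2 ^ m" using card_normal_words_pos[OF k(2), of m] by simp
    finally show "fa.dim (ideal_part k F m) < 2 ^ m" .
  qed (use k in simp)
next
  fix n :: nat and F :: "'k free_poly"
  assume n: "n \<ge> 3" and "F \<in> homogeneous_potentials (n + 1)"
  then have F: "potential F" "homogeneous (Suc n) F" by (simp_all add: homogeneous_potentials_def)
  show "coeffwise_le (minimal_series n) (hilbert_series F)"
    unfolding coeffwise_le_def
  proof
    fix m
    have "card (normal_words n m) \<le> 2 ^ m - fa.dim (ideal_part n F m)"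
      using dim_ideal_part_le_card_reducible_words[OF n F, of m] card_normal_words_le[of m n]
      unfolding card_reducible_words by linarith
    then have "(of_nat (card (normal_words n m)) :: rat) \<le> of_nat (2 ^ m - fa.dim (ideal_part n F m))"
      by (simp only: of_nat_le_iff)
    then show "fps_nth (minimal_series n) m \<le> fps_nth (hilbert_series F) m"
      using n hilbert_series_nth[OF _ F(2), of m] by (simp only: minimal_series_eq fps_nth_Abs_fps)
  qed
next
  fix n :: nat
  assume n: "n \<ge> 3"
  let ?M = "model_potential n :: 'k free_poly"
  have hom: "homogeneous (Suc n) ?M" using n by (simp add: homogeneous_model_potential)
  show "\<exists>F\<in>(homogeneous_potentials (n + 1) :: 'k free_poly set). hilbert_series F = minimal_series n"
  proof
    show "?M \<in> homogeneous_potentials (n + 1)"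
      using hom by (simp add: homogeneous_potentials_def potential_model_potential)
    show "hilbert_series ?M = minimal_series n"
    proof (rule fps_ext)
      fix m
      have "2 ^ m - fa.dim (ideal_part n ?M m) = card (normal_words n m)"
        unfolding dim_ideal_part_model_potential[OF n] card_reducible_words
        using card_normal_words_le[of m n] by simp
      then show "fps_nth (hilbert_series ?M) m = fps_nth (minimal_series n) m"
        using n hilbert_series_nth[OF _ hom, of m] by (simp only: minimal_series_eq fps_nth_Abs_fps)
    qed
  qed
qed

end
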